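(* Let $\tau>0$, $x_{\max}>c>0$, and let $\alpha_{\max}=\ln(x_{\max}/c)/\big((x_{\max}/c)-1\big)$. Suppose $\alpha\in(0,\pi\alpha_{\max}/2)$, and let $p_0=\frac{\tau}{\alpha}\ln\frac{x_{\max}}{c}$. Consider the delay-differential equation, for $t\ge 0$, $$\dot p(t)=\begin{cases}\frac{x_{\max}}{c}e^{-\frac{\alpha}{\tau}p(t-\tau)}-1 & p(t)>0,\\ \max\{0,\frac{x_{\max}}{c}e^{-\frac{\alpha}{\tau}p(t-\tau)}-1\} & p(t)\le 0,\end{cases}$$ written in the variable $z(t)=p(t)-p_0$, i.e. $$\dot z(t)=\begin{cases}e^{-\frac{\alpha}{\tau}z(t-\tau)}-1 & z(t)>-p_0,\\ \max\{0,e^{-\frac{\alpha}{\tau}z(t-\tau)}-1\} & z(t)\le -p_0,\end{cases}\qquad t\ge0,$$ with initial condition $z(\theta)=x_0(\theta)$ for $\theta\in[-\tau,0]$. Then this equation is asymptotically stable on $$X=\{x:\ x\in W_2\cap\mathcal C_\tau,\ x(\theta)\ge -p_0\ \text{for all }\theta\in[-\tau,0],\ x(-\tau)>-p_0\}.$$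
   Context: $\mathcal C_\tau$ is the space of continuous functions $[-\tau,0]\to\mathbb R$ with the supremum norm. $x\in W_2\cap \mathcal C_\tau$ means $x$ is absolutely continuous on $[-\tau,0]$ with derivative in $L_2[-\tau,0]$. Solutions are continuous functions on $[-\tau,\infty)$, absolutely continuous on $[0,\infty)$, satisfying the equation for almost every $t\ge0$. The solution map $A$ sends an initial condition $x_0$ to the corresponding solution $z$. The solution map $A$ is stable on $X\subset\mathcal C_\tau$ if (i) $Ax_0$ is bounded for every $x_0\in X$, and (ii) $A$ is continuous at $0$ with respect to the supremum norms on $\mathcal C_\tau$ and on continuous functions on $[-\tau,\infty)$ (i.e. for each $\varepsilon>0$ there is $\delta>0$ such that $\|x_0\|<\delta$ implies $\|Ax_0\|<\varepsilon$). It is asymptotically stable on $X$ if it is stable on $X$ and $\lim_{t\to\infty}(Ax_0)(t)=0$ for every $x_0\in X$. *)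

theory Defs
  imports "HOL-Analysis.Analysis"
begin

text \<open>Functions on a subset of the line are rendered as total functions \<open>real \<Rightarrow> real\<close> of which
  only the values on that subset matter.\<close>

text \<open>The \<open>\<epsilon>\<close>-\<open>\<delta>\<close> definition of absolute continuity on an interval \<open>S\<close>. A finite family of
  non-overlapping compact intervals contained in \<open>S\<close> is a division of some subset \<open>T\<close> of \<open>S\<close>;
  the interval \<open>K = [a, b]\<close> has \<open>Inf K = a\<close> and \<open>Sup K = b\<close>.\<close>

definition abs_continuous_on :: "real set \<Rightarrow> (real \<Rightarrow> real) \<Rightarrow> bool" where
  "abs_continuous_on S f \<longleftrightarrow>
     (\<forall>\<epsilon>>0. \<exists>\<delta>>0. \<forall>D T. D division_of T \<and> T \<subseteq> S \<and> (\<Sum>K\<in>D. Sup K - Inf K) < \<delta>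
        \<longrightarrow> (\<Sum>K\<in>D. \<bar>f (Sup K) - f (Inf K)\<bar>) < \<epsilon>)"

definition C_space :: "real \<Rightarrow> (real \<Rightarrow> real) set" where
  "C_space \<tau> = {x. continuous_on {-\<tau>..0} x}"

definition W2_space :: "real \<Rightarrow> (real \<Rightarrow> real) set" where
  "W2_space \<tau> = {x. abs_continuous_on {-\<tau>..0} x \<and>
     (\<exists>g. g \<in> borel_measurable (lebesgue_on {-\<tau>..0}) \<and>
          integrable (lebesgue_on {-\<tau>..0}) (\<lambda>\<theta>. (g \<theta>)\<^sup>2) \<and>
          (AE \<theta> in lebesgue_on {-\<tau>..0}. (x has_real_derivative g \<theta>) (at \<theta> within {-\<tau>..0})))}"

text \<open>On functions that are unbounded on \<open>S\<close> the value is meaningless; below the norm of a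
  trajectory is only used together with its boundedness.\<close>

definition sup_norm_on :: "real set \<Rightarrow> (real \<Rightarrow> real) \<Rightarrow> real" where
  "sup_norm_on S x = (SUP t\<in>S. \<bar>x t\<bar>)"

definition stable_on :: "real \<Rightarrow> (real \<Rightarrow> real) set \<Rightarrow> ((real \<Rightarrow> real) \<Rightarrow> real \<Rightarrow> real) \<Rightarrow> bool" where
  "stable_on \<tau> X A \<longleftrightarrow>
     (\<forall>x0\<in>X. bounded (A x0 ` {-\<tau>..})) \<and>
     (\<forall>\<epsilon>>0. \<exists>\<delta>>0. \<forall>x0\<in>X. sup_norm_on {-\<tau>..0} x0 < \<delta> \<longrightarrow> sup_norm_on {-\<tau>..} (A x0) < \<epsilon>)"

definition asymptotically_stable_on ::
    "real \<Rightarrow> (real \<Rightarrow> real) set \<Rightarrow> ((real \<Rightarrow> real) \<Rightarrow> real \<Rightarrow> real) \<Rightarrow> bool" where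
  "asymptotically_stable_on \<tau> X A \<longleftrightarrow>
     stable_on \<tau> X A \<and> (\<forall>x0\<in>X. ((A x0) \<longlongrightarrow> 0) at_top)"

text \<open>Below, \<open>u\<close> stands for the current value and \<open>v\<close> for the delayed
  value (the value at time \<open>t - \<tau>\<close>) of the unknown.\<close>

definition p_rhs :: "real \<Rightarrow> real \<Rightarrow> real \<Rightarrow> real \<Rightarrow> real \<Rightarrow> real \<Rightarrow> real" where
  "p_rhs \<tau> \<alpha> x_max c u v =
     (if u > 0 then x_max / c * exp (- (\<alpha> / \<tau>) * v) - 1
      else max 0 (x_max / c * exp (- (\<alpha> / \<tau>) * v) - 1))"

definition z_rhs :: "real \<Rightarrow> real \<Rightarrow> real \<Rightarrow> real \<Rightarrow> real \<Rightarrow> real" where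
  "z_rhs \<tau> \<alpha> p0 u v =
     (if u > - p0 then exp (- (\<alpha> / \<tau>) * v) - 1
      else max 0 (exp (- (\<alpha> / \<tau>) * v) - 1))"

lemma z_rhs_eq_p_rhs:
  assumes "\<tau> > 0" "\<alpha> > 0" "c > 0" "x_max > c" and p0: "p0 = \<tau> / \<alpha> * ln (x_max / c)"
  shows "z_rhs \<tau> \<alpha> p0 (u - p0) (v - p0) = p_rhs \<tau> \<alpha> x_max c u v"
proof -
  have "(\<alpha> / \<tau>) * p0 = ln (x_max / c)"
    using assms by (simp add: p0)
  then have "- (\<alpha> / \<tau>) * (v - p0) = ln (x_max / c) + - (\<alpha> / \<tau>) * v"
    by (simp add: right_diff_distrib)
  then have "exp (- (\<alpha> / \<tau>) * (v - p0)) = x_max / c * exp (- (\<alpha> / \<tau>) * v)"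
    using assms by (simp only: exp_add) simp
  then show ?thesis
    by (simp add: z_rhs_def p_rhs_def)
qed

text \<open>Extensionality fixes the irrelevant values of \<open>z\<close> outside \<open>[-\<tau>, \<infinity>)\<close>, so that
  uniqueness of solutions makes sense for total functions.\<close>

definition is_solution ::
    "real \<Rightarrow> real \<Rightarrow> real \<Rightarrow> (real \<Rightarrow> real) \<Rightarrow> (real \<Rightarrow> real) \<Rightarrow> bool" where
  "is_solution \<tau> \<alpha> p0 x0 z \<longleftrightarrow>
     z \<in> extensional {-\<tau>..} \<and>
     continuous_on {-\<tau>..} z \<and>
     abs_continuous_on {0..} z \<and>
     (\<forall>\<theta>\<in>{-\<tau>..0}. z \<theta> = x0 \<theta>) \<and>
     (AE t in lebesgue. t \<ge> 0 \<longrightarrow>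
        (z has_real_derivative z_rhs \<tau> \<alpha> p0 (z t) (z (t - \<tau>))) (at t))"

definition solution_map :: "real \<Rightarrow> real \<Rightarrow> real \<Rightarrow> (real \<Rightarrow> real) \<Rightarrow> real \<Rightarrow> real" where
  "solution_map \<tau> \<alpha> p0 x0 = (THE z. is_solution \<tau> \<alpha> p0 x0 z)"

definition initial_set :: "real \<Rightarrow> real \<Rightarrow> (real \<Rightarrow> real) set" where
  "initial_set \<tau> p0 =
     {x. x \<in> W2_space \<tau> \<inter> C_space \<tau> \<and> (\<forall>\<theta>\<in>{-\<tau>..0}. x \<theta> \<ge> - p0) \<and> x (- \<tau>) > - p0}"

end

theory Submission
  imports Defs
begin

text \<open>
In the variable \<open>y t = (\<alpha>/\<tau>) z (\<tau> t)\<close> the equation becomes \<open>y' t = - f (y (t - 1))\<close> with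
\<open>f v = \<alpha> (1 - exp (- v))\<close>, reflected at the floor \<open>-L\<close>, where \<open>L = ln (x_max/c)\<close>. On \<open>[-L, \<infinity>)\<close> the
concave function \<open>f\<close> lies in the sector \<open>f v / v \<le> k\<close> with \<open>k = \<alpha> (exp L - 1) / L\<close>, and the hypothesis
on \<open>\<alpha>\<close> is the inequality \<open>k < \<pi>/2\<close>. So the theorem is an instance of Popov's criterion for a delayed
integrator, provided that the reflection does no harm.

Popov's method is applied directly to the derivative \<open>s = y'\<close>. Three facts are combined in
\<open>energy_estimate\<close>. First, the sector condition \<open>(s t)\<^sup>2 \<le> - k s t y (t - 1)\<close> survives reflection, because
reflection only replaces the forcing by \<open>0\<close>. Second, the integral of \<open>s t s (t - 1)\<close> is bounded
above by a potential of the initial value (\<open>popov_integral\<close>): between visits to the floor it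
telescopes, and on each visit the potential is lost, which has the right sign. Third, the
frequency-domain inequality \<open>sin \<omega> / \<omega> \<le> 2/\<pi> + (4/\<pi>\<^sup>2) cos \<omega>\<close> (\<open>sin_le_popov\<close>) turns into a quadratic
inequality for \<open>s\<close> (\<open>delay_form_le\<close>). The latter is obtained by sampling \<open>s\<close>, using finite
trigonometric sums for the samples, and passing to the limit. The result bounds \<open>y T\<close> and the
integral of \<open>s\<^sup>2\<close> by the initial values. Smallness of the bound for small initial values is
stability (\<open>y_bound\<close>), and finiteness of the integral gives convergence to \<open>0\<close> (\<open>y_tendsto_0\<close>).

Solutions exist by the method of steps, each step being Skorokhod's explicit reflection formula.
The reflected path is differentiable off a countable set (\<open>countable_corners\<close>, \<open>slope_deriv\<close>), so it
solves the equation almost everywhere. Uniqueness holds because the right-hand side is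
nonincreasing in the current value; it uses that an absolutely continuous function is the
integral of its almost-everywhere derivative (\<open>has_integral_abs_continuous\<close>).
\<close>

section \<open>Absolutely continuous functions\<close>

lemma abs_continuous_on_subset:
  "abs_continuous_on S f \<Longrightarrow> T \<subseteq> S \<Longrightarrow> abs_continuous_on T f"
  unfolding abs_continuous_on_def by (meson order_trans)

lemma abs_continuous_on_lipschitz:
  assumes "\<And>s t. s \<in> S \<Longrightarrow> t \<in> S \<Longrightarrow> s \<le> t \<Longrightarrow> \<bar>f t - f s\<bar> \<le> C * (t - s)"
  shows "abs_continuous_on S f"
  unfolding abs_continuous_on_def
proof (intro allI impI)
  fix e :: real assume "e > 0"
  define d where "d = e / (\<bar>C\<bar> + 1)"
  have d: "d > 0" using \<open>e > 0\<close> by (simp add: d_def)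
  show "\<exists>d>0. \<forall>D T. D division_of T \<and> T \<subseteq> S \<and> (\<Sum>K\<in>D. Sup K - Inf K) < d \<longrightarrow>
      (\<Sum>K\<in>D. \<bar>f (Sup K) - f (Inf K)\<bar>) < e"
  proof (intro exI[of _ d] conjI allI impI d)
    fix D T assume D: "D division_of T \<and> T \<subseteq> S \<and> (\<Sum>K\<in>D. Sup K - Inf K) < d"
    have K: "\<bar>f (Sup K) - f (Inf K)\<bar> \<le> (\<bar>C\<bar> + 1) * (Sup K - Inf K)" if KD: "K \<in> D" for K
    proof -
      have "K \<subseteq> S" "K \<noteq> {}" using D KD division_ofD(2,3)[of D T K] by auto
      obtain a b where "K = {a..b}"
        using division_ofD(4)[OF conjunct1[OF D] KD] by auto
      with \<open>K \<subseteq> S\<close> \<open>K \<noteq> {}\<close> have "\<bar>f (Sup K) - f (Inf K)\<bar> \<le> C * (Sup K - Inf K)" "Sup K - Inf K \<ge> 0"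
        by (auto intro!: assms)
      moreover have "C * (Sup K - Inf K) \<le> (\<bar>C\<bar> + 1) * (Sup K - Inf K)"
        using calculation by (intro mult_right_mono) auto
      ultimately show ?thesis by linarith
    qed
    have "(\<Sum>K\<in>D. \<bar>f (Sup K) - f (Inf K)\<bar>) \<le> (\<bar>C\<bar> + 1) * (\<Sum>K\<in>D. Sup K - Inf K)"
      unfolding sum_distrib_left by (intro sum_mono K)
    also have "\<dots> < (\<bar>C\<bar> + 1) * d"
      using D by (intro mult_strict_left_mono) auto
    also have "\<dots> = e" by (simp add: d_def)
    finally show "(\<Sum>K\<in>D. \<bar>f (Sup K) - f (Inf K)\<bar>) < e" .
  qed
qed

lemma abs_continuous_on_diff:
  assumes f: "abs_continuous_on S f" and g: "abs_continuous_on S g"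
  shows "abs_continuous_on S (\<lambda>t. f t - g t)"
  unfolding abs_continuous_on_def
proof (intro allI impI)
  fix e :: real assume "e > 0"
  then have "e/2 > 0" by simp
  obtain d1 where d1: "d1 > 0" "\<forall>D T. D division_of T \<and> T \<subseteq> S \<and> (\<Sum>K\<in>D. Sup K - Inf K) < d1 \<longrightarrow>
        (\<Sum>K\<in>D. \<bar>f (Sup K) - f (Inf K)\<bar>) < e/2"
    using f[unfolded abs_continuous_on_def, rule_format, OF \<open>e/2 > 0\<close>] by blast
  obtain d2 where d2: "d2 > 0" "\<forall>D T. D division_of T \<and> T \<subseteq> S \<and> (\<Sum>K\<in>D. Sup K - Inf K) < d2 \<longrightarrow>
        (\<Sum>K\<in>D. \<bar>g (Sup K) - g (Inf K)\<bar>) < e/2"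
    using g[unfolded abs_continuous_on_def, rule_format, OF \<open>e/2 > 0\<close>] by blast
  show "\<exists>d>0. \<forall>D T. D division_of T \<and> T \<subseteq> S \<and> (\<Sum>K\<in>D. Sup K - Inf K) < d \<longrightarrow>
      (\<Sum>K\<in>D. \<bar>(f (Sup K) - g (Sup K)) - (f (Inf K) - g (Inf K))\<bar>) < e"
  proof (intro exI[of _ "min d1 d2"] conjI allI impI)
    fix D T assume D: "D division_of T \<and> T \<subseteq> S \<and> (\<Sum>K\<in>D. Sup K - Inf K) < min d1 d2"
    have "(\<Sum>K\<in>D. \<bar>(f (Sup K) - g (Sup K)) - (f (Inf K) - g (Inf K))\<bar>)
        \<le> (\<Sum>K\<in>D. \<bar>f (Sup K) - f (Inf K)\<bar> + \<bar>g (Sup K) - g (Inf K)\<bar>)"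
      by (intro sum_mono) auto
    also have "\<dots> = (\<Sum>K\<in>D. \<bar>f (Sup K) - f (Inf K)\<bar>) + (\<Sum>K\<in>D. \<bar>g (Sup K) - g (Inf K)\<bar>)"
      by (rule sum.distrib)
    also have "\<dots> < e" using d1(2)[rule_format, of D T] d2(2)[rule_format, of D T] D by auto
    finally show "(\<Sum>K\<in>D. \<bar>(f (Sup K) - g (Sup K)) - (f (Inf K) - g (Inf K))\<bar>) < e" .
  qed (use d1 d2 in auto)
qed

lemma negligible_countable: "countable N \<Longrightarrow> negligible (N :: real set)"
  by (simp add: negligible_iff_null_sets null_sets_completionI countable_imp_null_set_lborel)

text \<open>A gauge proof. Off the null set \<open>N\<close> the gauge comes from differentiability, as in the
fundamental theorem of calculus. At tags in \<open>N\<close> it only confines the interval to an open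
superset of \<open>N\<close> of measure less than \<open>\<delta>\<close>; these intervals form a division of some set, so
absolute continuity bounds the increments of \<open>f\<close> over them by \<open>\<epsilon>\<close>.\<close>

lemma has_integral_abs_continuous:
  fixes f D :: "real \<Rightarrow> real"
  assumes "a \<le> b" and ac: "abs_continuous_on {a..b} f" and N: "negligible N"
    and der: "\<And>t. t \<in> {a..b} - N \<Longrightarrow> (f has_real_derivative D t) (at t within {a..b})"
  shows "(D has_integral (f b - f a)) {a..b}"
proof -
  \<comment> \<open>The values of \<open>D\<close> on \<open>N\<close> are arbitrary; zero makes the tags in \<open>N\<close> contribute only increments of \<open>f\<close>.\<close>
  define D0 where "D0 = (\<lambda>t. if t \<in> N then 0 else D t)"
  have "(D0 has_integral (f b - f a)) (cbox a b)"
    unfolding has_integral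
  proof (intro allI impI)
    fix e :: real assume "e > 0"
    define e1 where "e1 = e / (2 * (b - a + 1))"
    have e1: "e1 > 0" using \<open>e > 0\<close> \<open>a \<le> b\<close> by (simp add: e1_def)
    have e1': "e1 * (b - a) < e / 2"
      using \<open>e > 0\<close> \<open>a \<le> b\<close> by (simp add: e1_def field_simps)
    have "e / 2 > 0" using \<open>e > 0\<close> by simp
    then obtain d where d: "d > 0" and acd: "\<And>D T. D division_of T \<Longrightarrow> T \<subseteq> {a..b} \<Longrightarrow>
        (\<Sum>K\<in>D. Sup K - Inf K) < d \<Longrightarrow> (\<Sum>K\<in>D. \<bar>f (Sup K) - f (Inf K)\<bar>) < e/2"
      using ac unfolding abs_continuous_on_def by meson
    have N_lm: "N \<in> lmeasurable" "measure lebesgue N = 0"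
      using N negligible_iff_measure by blast+
    obtain U where U0: "open U" "N \<subseteq> U" "U - N \<in> lmeasurable" "emeasure lebesgue (U - N) < ennreal d"
      using sets_lebesgue_outer_open[OF fmeasurableD[OF N_lm(1)] d] by blast
    have UN: "U = (U - N) \<union> N" using U0(2) by blast
    have "measure lebesgue (U - N) < d"
      using U0(3,4) d by (simp add: emeasure_eq_measure2 ennreal_less_iff)
    moreover have "measure lebesgue U \<le> measure lebesgue (U - N) + measure lebesgue N"
      using measure_Un_le[OF fmeasurableD[OF U0(3)] fmeasurableD[OF N_lm(1)]] UN by simp
    moreover have "U \<in> lmeasurable"
      using fmeasurable.Un[OF U0(3) N_lm(1)] UN by simp
    ultimately have U: "open U" "N \<subseteq> U" "U \<in> lmeasurable" "measure lebesgue U < d"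
      using U0 N_lm by auto
    have "\<exists>r>0. \<forall>u v. u \<in> {a..b} \<and> v \<in> {a..b} \<and> u \<le> t \<and> t \<le> v \<and> u \<in> ball t r \<and> v \<in> ball t r \<longrightarrow>
       \<bar>f v - f u - D t * (v - u)\<bar> \<le> e1 * (v - u)" if t: "t \<in> {a..b} - N" for t
    proof -
      have "(f has_derivative (*) (D t)) (at t within {a..b})"
        using der[OF t] by (simp add: has_field_derivative_def)
      then obtain r where r: "r > 0" "\<And>y. y \<in> {a..b} \<Longrightarrow> norm (y - t) < r \<Longrightarrow>
           norm (f y - f t - D t * (y - t)) \<le> e1 * norm (y - t)"
        using e1 unfolding has_derivative_within_alt by blast
      show ?thesis
      proof (intro exI[of _ r] conjI allI impI r)
        fix u v assume uv: "u \<in> {a..b} \<and> v \<in> {a..b} \<and> u \<le> t \<and> t \<le> v \<and> u \<in> ball t r \<and> v \<in> ball t r"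
        have "\<bar>f u - f t - D t * (u - t)\<bar> \<le> e1 * (t - u)" "\<bar>f v - f t - D t * (v - t)\<bar> \<le> e1 * (v - t)"
          using r(2)[of u] r(2)[of v] uv by (auto simp: dist_real_def)
        then have "\<bar>f v - f u - D t * (v - u)\<bar> \<le> e1 * (t - u) + e1 * (v - t)"
          by (simp add: algebra_simps abs_if split: if_splits)
        then show "\<bar>f v - f u - D t * (v - u)\<bar> \<le> e1 * (v - u)"
          by (simp add: algebra_simps)
      qed
    qed
    then obtain r where r: "\<And>t. t \<in> {a..b} - N \<Longrightarrow> r t > 0"
      "\<And>t u v. t \<in> {a..b} - N \<Longrightarrow> u \<in> {a..b} \<Longrightarrow> v \<in> {a..b} \<Longrightarrow> u \<le> t \<Longrightarrow> t \<le> v \<Longrightarrow>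
         u \<in> ball t (r t) \<Longrightarrow> v \<in> ball t (r t) \<Longrightarrow> \<bar>f v - f u - D t * (v - u)\<bar> \<le> e1 * (v - u)"
      by metis
    define \<gamma> where "\<gamma> t = (if t \<in> N then U else if t \<in> {a..b} then ball t (r t) else ball t 1)" for t
    have g: "gauge \<gamma>"
      using U r(1) unfolding gauge_def \<gamma>_def by auto
    have bound: "norm ((\<Sum>(x,k)\<in>p. measure lborel k *\<^sub>R D0 x) - (f b - f a)) < e"
      if p: "p tagged_division_of cbox a b" and fine: "\<gamma> fine p" for p
    proof -
      have p': "p tagged_division_of {a..b}" using p by simp
      note pD = tagged_division_ofD[OF p]
      define c where "c = (\<lambda>(x::real,K). measure lborel K * D0 x - (f (Sup K) - f (Inf K)))"
      have "(\<Sum>(x,k)\<in>p. measure lborel k *\<^sub>R D0 x) - (f b - f a) = (\<Sum>xk\<in>p. c xk)"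
        unfolding additive_tagged_division_1[OF \<open>a \<le> b\<close> p', symmetric] sum_subtractf[symmetric]
        by (intro sum.cong) (auto simp: c_def)
      also have "\<bar>\<dots>\<bar> \<le> (\<Sum>xk\<in>p. \<bar>c xk\<bar>)" by (rule sum_abs)
      also have "\<dots> \<le> (\<Sum>(x,K)\<in>p. e1 * measure lborel K + (if x \<in> N then \<bar>f (Sup K) - f (Inf K)\<bar> else 0))"
      proof (intro sum_mono, clarify)
        fix x K assume xK: "(x,K) \<in> p"
        obtain u v where K: "K = cbox u v" using pD(4)[OF xK] by blast
        have "x \<in> K" "K \<subseteq> {a..b}" using pD(2,3)[OF xK] by auto
        then have uv: "u \<le> x" "x \<le> v" "u \<in> {a..b}" "v \<in> {a..b}" "x \<in> {a..b}" using K by auto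
        have SI: "Sup K = v" "Inf K = u" "measure lborel K = v - u" using uv K by auto
        have sub: "K \<subseteq> \<gamma> x" using fine xK by (auto simp: fine_def)
        show "\<bar>c (x,K)\<bar> \<le> e1 * measure lborel K + (if x \<in> N then \<bar>f (Sup K) - f (Inf K)\<bar> else 0)"
        proof (cases "x \<in> N")
          case True
          then show ?thesis using e1 uv by (simp add: c_def D0_def SI abs_minus_commute[of "f u"])
        next
          case False
          have "K \<subseteq> ball x (r x)" using sub False uv by (simp add: \<gamma>_def)
          moreover have "u \<in> K" "v \<in> K" using K uv by auto
          ultimately have "u \<in> ball x (r x)" "v \<in> ball x (r x)" by blast+
          then have "\<bar>f v - f u - D x * (v - u)\<bar> \<le> e1 * (v - u)"
            using False uv by (intro r(2)) auto
          then show ?thesis using False by (simp add: c_def D0_def SI algebra_simps abs_minus_commute)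
        qed
      qed
      also have "\<dots> = e1 * (\<Sum>(x,K)\<in>p. measure lborel K) + (\<Sum>(x,K)\<in>p. if x \<in> N then \<bar>f (Sup K) - f (Inf K)\<bar> else 0)"
        by (simp add: sum.distrib sum_distrib_left case_prod_unfold)
      also have "(\<Sum>(x,K)\<in>p. measure lborel K) = b - a"
        using additive_content_tagged_division[OF p] \<open>a \<le> b\<close> by simp
      also have "(\<Sum>(x,K)\<in>p. if x \<in> N then \<bar>f (Sup K) - f (Inf K)\<bar> else 0) < e / 2"
      proof -
        define q where "q = {xk\<in>p. fst xk \<in> N}"
        have q: "q tagged_partial_division_of {a..b}"
          using tagged_partial_division_subset[of p "{a..b}" q] p'
          by (auto simp: q_def tagged_division_of_def)
        note qd = partial_division_of_tagged_division[OF q]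
        note qU = tagged_partial_division_of_Union_self[OF q]
        have qf: "finite p" using pD(1) .
        have "(\<Sum>(x,K)\<in>p. if x \<in> N then \<bar>f (Sup K) - f (Inf K)\<bar> else 0)
            = (\<Sum>(x,K)\<in>q. \<bar>f (Sup K) - f (Inf K)\<bar>)"
          unfolding q_def by (simp add: sum.inter_filter[OF qf] case_prod_unfold)
        also have "\<dots> = (\<Sum>(x,K)\<in>q. if K = {} then 0 else \<bar>f (Sup K) - f (Inf K)\<bar>)"
          using tagged_partial_division_ofD(2)[OF q] by (intro sum.cong) (simp, force)
        also have "\<dots> = (\<Sum>K\<in>snd ` q. if K = {} then 0 else \<bar>f (Sup K) - f (Inf K)\<bar>)"
          by (rule sum.over_tagged_division_lemma[OF qU]) (auto simp: box_eq_empty not_less)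
        also have "\<dots> = (\<Sum>K\<in>snd ` q. \<bar>f (Sup K) - f (Inf K)\<bar>)"
          using division_ofD(3)[OF qd] by (intro sum.cong) auto
        also have "\<dots> < e / 2"
        proof (rule acd[OF qd])
          show sub: "\<Union> (snd ` q) \<subseteq> {a..b}"
            using pD(3) by (force simp: q_def)
          have SI: "Sup K - Inf K = measure lebesgue K" if Kq: "K \<in> snd ` q" for K
          proof -
            obtain u v where "K = {u..v}" "K \<noteq> {}"
              using division_ofD(3,4)[OF qd Kq] by auto
            then show ?thesis by auto
          qed
          have "(\<Sum>K\<in>snd ` q. Sup K - Inf K) = (\<Sum>K\<in>snd ` q. measure lebesgue K)"
            using SI by simp
          also have "\<dots> = measure lebesgue (\<Union> (snd ` q))"
            using content_division[OF qd] by simp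
          also have "\<dots> \<le> measure lebesgue U"
          proof (rule measure_mono_fmeasurable)
            show "\<Union> (snd ` q) \<subseteq> U"
              using fine by (force simp: q_def fine_def \<gamma>_def)
            show "\<Union> (snd ` q) \<in> sets lebesgue"
              using lmeasurable_division[OF qd] by blast
          qed (rule U)
          also have "\<dots> < d" by (rule U)
          finally show "(\<Sum>K\<in>snd ` q. Sup K - Inf K) < d" .
        qed
        finally show ?thesis .
      qed
      finally show ?thesis using e1' by (simp add: mult.commute)
    qed
    show "\<exists>\<gamma>. gauge \<gamma> \<and> (\<forall>p. p tagged_division_of cbox a b \<and> \<gamma> fine p \<longrightarrow>
        norm ((\<Sum>(x,k)\<in>p. measure lborel k *\<^sub>R D0 x) - (f b - f a)) < e)"
    proof (intro exI[of _ \<gamma>] conjI g allI impI)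
      fix p assume "p tagged_division_of cbox a b \<and> \<gamma> fine p"
      then show "norm ((\<Sum>(x,k)\<in>p. measure lborel k *\<^sub>R D0 x) - (f b - f a)) < e"
        using bound by (elim conjE)
    qed
  qed
  then show ?thesis
    using has_integral_spike[OF N, of "{a..b}" D D0] by (simp add: D0_def)
qed

section \<open>The reflected integrator\<close>

definition running_max :: "(real \<Rightarrow> real) \<Rightarrow> real \<Rightarrow> real \<Rightarrow> real" where
  "running_max g m t = Sup (insert m (g ` {0..t}))"

lemma
  assumes g: "continuous_on UNIV g"
  shows running_max_upper: "0 \<le> s \<Longrightarrow> s \<le> t \<Longrightarrow> g s \<le> running_max g m t"
    and running_max_initial: "m \<le> running_max g m t"
    and running_max_least: "\<And>c. m \<le> c \<Longrightarrow> (\<And>r. 0 \<le> r \<Longrightarrow> r \<le> t \<Longrightarrow> g r \<le> c) \<Longrightarrow> running_max g m t \<le> c"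
proof -
  have "compact (g ` {0..t})"
    by (intro compact_continuous_image continuous_on_subset[OF g]) auto
  then have bdd: "bdd_above (insert m (g ` {0..t}))"
    by (simp add: bounded_imp_bdd_above compact_imp_bounded)
  show "0 \<le> s \<Longrightarrow> s \<le> t \<Longrightarrow> g s \<le> running_max g m t"
    unfolding running_max_def by (rule cSup_upper[OF _ bdd]) auto
  show "m \<le> running_max g m t"
    unfolding running_max_def by (rule cSup_upper[OF _ bdd]) auto
  show "running_max g m t \<le> c" if "m \<le> c" "\<And>r. 0 \<le> r \<Longrightarrow> r \<le> t \<Longrightarrow> g r \<le> c" for c
    unfolding running_max_def by (rule cSup_least) (use that in auto)
qed

lemma running_max_mono:
  assumes g: "continuous_on UNIV g" and "s \<le> t"
  shows "running_max g m s \<le> running_max g m t"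
  using assms(2) by (intro running_max_least[OF g] running_max_initial[OF g] running_max_upper[OF g]) auto

lemma running_max_step:
  assumes g: "continuous_on UNIV g" and "running_max g m s \<le> c"
    and "\<And>r. s \<le> r \<Longrightarrow> r \<le> t \<Longrightarrow> g r \<le> c"
  shows "running_max g m t \<le> c"
proof (rule running_max_least[OF g])
  show "m \<le> c" using running_max_initial[OF g] assms(2) order_trans by blast
  show "g r \<le> c" if "0 \<le> r" "r \<le> t" for r
    using running_max_upper[OF g \<open>0 \<le> r\<close>, of s m] assms that by (cases "r \<le> s") force+
qed

lemma continuous_running_max:
  assumes g: "continuous_on UNIV g"
  shows "continuous_on {0..} (running_max g m)"
  unfolding continuous_on_iff
proof (intro ballI allI impI)
  fix t e :: real assume t: "t \<in> {0..}" and e: "e > 0"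
  obtain d where d: "d > 0" "\<And>r. \<bar>r - t\<bar> < d \<Longrightarrow> \<bar>g r - g t\<bar> < e / 4"
    using g e unfolding continuous_on_iff dist_real_def
    by (metis UNIV_I divide_pos_pos zero_less_numeral)
  have step: "running_max g m r' - running_max g m r \<le> e / 2"
    if "0 \<le> r" "r \<le> r'" "\<bar>r - t\<bar> < d" "\<bar>r' - t\<bar> < d" for r r'
  proof -
    have "g r \<le> running_max g m r" using running_max_upper[OF g] that by blast
    have "g q \<le> running_max g m r + e / 2" if "r \<le> q" "q \<le> r'" for q
      using d(2)[of q] d(2)[of r] that \<open>\<bar>r - t\<bar> < d\<close> \<open>\<bar>r' - t\<bar> < d\<close> \<open>g r \<le> running_max g m r\<close> by linarith
    then have "running_max g m r' \<le> running_max g m r + e / 2"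
      using e by (intro running_max_step[OF g, of m r "running_max g m r + e / 2" r']) (simp_all only: less_imp_le half_gt_zero le_add_same_cancel1)
    then show ?thesis by simp
  qed
  show "\<exists>d>0. \<forall>x'\<in>{0..}. dist x' t < d \<longrightarrow> dist (running_max g m x') (running_max g m t) < e"
  proof (intro exI[of _ d] conjI ballI impI)
    fix r assume r: "r \<in> {0..}" "dist r t < d"
    show "dist (running_max g m r) (running_max g m t) < e"
      using step[of r t] step[of t r] running_max_mono[OF g, of r t m] running_max_mono[OF g, of t r m] r t d e
      by (cases "r \<le> t") (auto simp: dist_real_def)
  qed (use d in auto)
qed

text \<open>Skorokhod's formula: \<open>U\<close> is pushed up by the least nondecreasing amount that keeps it above
\<open>-b\<close>. This gives the solution of \<open>z' = u\<close> (above \<open>-b\<close>), \<open>z' = max 0 u\<close> (at \<open>-b\<close>) in closed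
form, without solving a discontinuous differential equation.\<close>

definition reflected :: "real \<Rightarrow> real \<Rightarrow> (real \<Rightarrow> real) \<Rightarrow> real \<Rightarrow> real" where
  "reflected b z0 U t = U t + running_max (\<lambda>s. - b - U s) z0 t"

locale reflected_path =
  fixes b z0 :: real and u U :: "real \<Rightarrow> real"
  assumes u: "continuous_on UNIV u"
    and U: "\<And>t. (U has_real_derivative u t) (at t)"
    and U0: "U 0 = 0"
    and z0: "z0 \<ge> - b"
begin

abbreviation z where "z \<equiv> reflected b z0 U"

abbreviation k where "k \<equiv> running_max (\<lambda>s. - b - U s) z0"

lemma cont_U: "continuous_on A U"
  using U by (meson DERIV_isCont continuous_at_imp_continuous_on)

lemma cont_g: "continuous_on UNIV (\<lambda>s. - b - U s)"
  by (intro continuous_intros cont_U)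

lemma z_eq: "z t = U t + k t"
  by (simp add: reflected_def)

lemma z_0: "z 0 = z0"
proof -
  have "k 0 = z0"
    using running_max_initial[OF cont_g, of z0 0] running_max_least[OF cont_g, of z0 z0 0] z0 U0
    by (force intro: antisym)
  then show ?thesis by (simp add: z_eq U0)
qed

lemma z_ge: "t \<ge> 0 \<Longrightarrow> z t \<ge> - b"
  using running_max_upper[OF cont_g, of t t z0] by (simp add: z_eq)

lemma cont_z: "continuous_on {0..} z"
  unfolding reflected_def by (intro continuous_intros cont_U continuous_running_max cont_g)

lemma z_incr: "s \<le> t \<Longrightarrow> U t - U s \<le> z t - z s"
  using running_max_mono[OF cont_g, of s t z0] by (simp add: z_eq)

lemma z_step:
  assumes "z s - U s \<le> c" "\<And>r. s \<le> r \<Longrightarrow> r \<le> t \<Longrightarrow> - b - U r \<le> c"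
  shows "z t - U t \<le> c"
  using running_max_step[OF cont_g, of z0 s c t] assms by (simp add: z_eq)

lemma U_lipschitz:
  assumes "s \<le> t" "\<And>r. s \<le> r \<Longrightarrow> r \<le> t \<Longrightarrow> \<bar>u r\<bar> \<le> C"
  shows "\<bar>U t - U s\<bar> \<le> C * (t - s)"
proof (cases "s = t")
  case False
  then obtain r where "s < r" "r < t" "U t - U s = (t - s) * u r"
    using MVT2[of s t U u] assms(1) U by force
  moreover have "\<bar>u r\<bar> \<le> C" using calculation by (intro assms(2)) auto
  ultimately show ?thesis using assms(1) by (simp add: abs_mult mult_left_mono mult.commute)
qed simp

lemma z_lipschitz:
  assumes "0 \<le> s" "s \<le> t" "\<And>r. s \<le> r \<Longrightarrow> r \<le> t \<Longrightarrow> \<bar>u r\<bar> \<le> C"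
  shows "\<bar>z t - z s\<bar> \<le> C * (t - s)"
proof -
  have "0 \<le> C" using assms(3)[of s] assms(2) by simp
  have 1: "- (C * (t - s)) \<le> z t - z s"
    using U_lipschitz[of s t C] z_incr[of s t] assms by force
  have "z t - U t \<le> z s - U t + C * (t - s)"
  proof (rule z_step)
    show "z s - U s \<le> z s - U t + C * (t - s)"
      using U_lipschitz[of s t C] assms by force
    show "- b - U r \<le> z s - U t + C * (t - s)" if "s \<le> r" "r \<le> t" for r
    proof -
      have "\<bar>U t - U r\<bar> \<le> C * (t - r)" using that assms by (intro U_lipschitz) auto
      also have "\<dots> \<le> C * (t - s)" using that \<open>0 \<le> C\<close> by (intro mult_left_mono) auto
      finally show ?thesis using z_ge[OF assms(1)] by linarith
    qed
  qed
  with 1 show ?thesis by linarith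
qed

lemma z_deriv_interior:
  assumes t: "t > 0" and zt: "z t > - b"
  shows "(z has_real_derivative u t) (at t)"
proof -
  define e where "e = (z t + b) / 3"
  have e: "e > 0" using zt by (simp add: e_def)
  have iz: "isCont z t" using cont_z t
    continuous_on_interior[of "{0..}" z t] by simp
  have "\<forall>\<^sub>F s in at t. \<bar>z s - z t\<bar> < e \<and> \<bar>U s - U t\<bar> < e \<and> s > 0"
    using iz DERIV_isCont[OF U[of t]] e t unfolding isCont_def tendsto_iff dist_real_def
    by (intro eventually_conj) (auto intro: eventually_at_topological[THEN iffD2]
        order_tendstoD(1)[OF tendsto_ident_at])
  then obtain d where d: "d > 0" "\<And>s. s \<noteq> t \<Longrightarrow> dist s t < d \<Longrightarrow> \<bar>z s - z t\<bar> < e \<and> \<bar>U s - U t\<bar> < e \<and> s > 0"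
    unfolding eventually_at by blast
  have d': "\<bar>z s - z t\<bar> < e \<and> \<bar>U s - U t\<bar> < e \<and> s > 0" if "\<bar>s - t\<bar> < d" for s
    using d(2)[of s] that e t by (cases "s = t") (auto simp: dist_real_def)
  have up: "k s' \<le> k s" if "s \<le> s'" "\<bar>s - t\<bar> < d" "\<bar>s' - t\<bar> < d" for s s'
  proof (rule running_max_step[OF cont_g order_refl])
    fix r assume "s \<le> r" "r \<le> s'"
    then have "\<bar>r - t\<bar> < d" using that by linarith
    with d'[of r] d'[of s] that have "\<bar>U r - U t\<bar> < e" "\<bar>U s - U t\<bar> < e" "\<bar>z s - z t\<bar> < e" by auto
    moreover have "k s = z s - U s" by (simp add: z_eq)
    moreover have "z t + b = 3 * e" by (simp add: e_def)
    ultimately show "- b - U r \<le> k s" by linarith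
  qed
  have keq: "k s = k t" if "\<bar>s - t\<bar> < d" for s
    using up[of s t] up[of t s] running_max_mono[OF cont_g, of s t z0] running_max_mono[OF cont_g, of t s z0] that d(1)
    by (cases "s \<le> t") auto
  have "((\<lambda>s. U s + k t) has_real_derivative u t) (at t)"
    using DERIV_add[OF U[of t] DERIV_const[of "k t"]] by simp
  moreover have "z s = U s + k t" if "dist s t < d" for s
    using keq[of s] that by (simp add: z_eq dist_real_def)
  then have "\<forall>\<^sub>F s in nhds t. z s = U s + k t"
    using d(1) unfolding eventually_nhds_metric by blast
  ultimately show ?thesis
    using DERIV_cong_ev[of t t z "\<lambda>s. U s + k t" "u t" "u t"] by blast
qed

lemma u_nonpos_at_floor:
  assumes t: "t > 0" and zt: "z t = - b"
  shows "u t \<le> 0"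
proof (rule ccontr)
  assume "\<not> u t \<le> 0"
  then obtain d where d: "d > 0" "\<And>h. 0 < h \<Longrightarrow> h < d \<Longrightarrow> U (t - h) < U t"
    using DERIV_pos_inc_left[OF U[of t]] by auto
  define h where "h = min (d/2) (t/2)"
  have "0 < h" "h < d" "h < t" using d t by (auto simp: h_def)
  then have "z (t - h) < - b" using d(2)[of h] z_incr[of "t - h" t] zt by force
  then show False using z_ge[of "t - h"] \<open>h < t\<close> by simp
qed

text \<open>Where \<open>u t = 0\<close> at the floor, \<open>C\<close> can be taken arbitrarily small near \<open>t\<close>; this is what makes
\<open>z\<close> differentiable there even if excursions from the floor accumulate at \<open>t\<close>.\<close>

lemma z_near_floor:
  assumes "0 \<le> s" "0 \<le> t" "z t = - b" "\<And>r. \<bar>r - t\<bar> \<le> \<bar>s - t\<bar> \<Longrightarrow> \<bar>u r\<bar> \<le> C"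
  shows "\<bar>z s + b\<bar> \<le> C * \<bar>s - t\<bar>"
proof (cases "s \<le> t")
  case True
  then show ?thesis using z_lipschitz[of s t C] assms by (auto simp: abs_minus_commute)
next
  case False
  then show ?thesis using z_lipschitz[of t s C] assms by auto
qed

lemma z_sticks:
  assumes "0 \<le> t" "t \<le> s" "z t = - b" "\<And>r. t \<le> r \<Longrightarrow> r \<le> s \<Longrightarrow> u r \<le> 0"
  shows "z s = - b"
proof -
  have mono: "U s \<le> U r" if "t \<le> r" "r \<le> s" for r
  proof (rule DERIV_nonpos_imp_nonincreasing[OF \<open>r \<le> s\<close>])
    fix x assume "r \<le> x" "x \<le> s"
    then show "\<exists>y. (U has_real_derivative y) (at x) \<and> y \<le> 0" using U[of x] assms(4)[of x] that by auto
  qed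
  have "z s - U s \<le> - b - U s"
    by (rule z_step[of t]) (use mono[of t] mono assms in auto)
  then show ?thesis using z_ge[of s] assms by simp
qed

text \<open>The times at which an excursion ends on the floor. They are the only positive times at which
the path can fail to be differentiable.\<close>

definition corners :: "real set" where
  "corners = {t. t > 0 \<and> z t = - b \<and> (\<exists>d>0. \<forall>s. t - d < s \<and> s < t \<longrightarrow> z s > - b)}"

text \<open>The open intervals on which the excursions ending at two different corners finish are disjoint,
so each corner can be labelled by a rational in its own interval.\<close>

lemma countable_corners: "countable corners"
proof -
  have "\<exists>q::rat. \<exists>d>0. t - d < of_rat q \<and> of_rat q < t \<and> (\<forall>s. t - d < s \<and> s < t \<longrightarrow> z s > - b)"
    if "t \<in> corners" for t
  proof -
    from that obtain d where d: "d > 0" "\<forall>s. t - d < s \<and> s < t \<longrightarrow> z s > - b"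
      by (auto simp: corners_def)
    obtain q :: rat where "t - d < of_rat q" "of_rat q < t"
      using of_rat_dense[of "t - d" t] d by auto
    with d show ?thesis by blast
  qed
  then obtain q :: "real \<Rightarrow> rat" and d where q: "\<And>t. t \<in> corners \<Longrightarrow>
     d t > 0 \<and> t - d t < of_rat (q t) \<and> of_rat (q t) < t \<and> (\<forall>s. t - d t < s \<and> s < t \<longrightarrow> z s > - b)"
    by metis
  have "inj_on q corners"
  proof (rule inj_onI)
    have False if "s \<in> corners" "t \<in> corners" "q s = q t" "s < t" for s t
    proof -
      have "t - d t < s" using q[of s] q[of t] that by auto
      then have "z s > - b" using q[of t] that by auto
      then show False using that by (simp add: corners_def)
    qed
    then show "s = t" if "s \<in> corners" "t \<in> corners" "q s = q t" for s t
      using that by (metis linorder_neqE)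
  qed
  then show ?thesis by (rule countableI')
qed

definition slope :: "real \<Rightarrow> real" where
  "slope t = (if z t > - b then u t else 0)"

text \<open>If \<open>u t < 0\<close>, the path sticks to the floor right after \<open>t\<close>, and, as \<open>t\<close> is not a corner, the
path visits the floor shortly before \<open>t\<close> and sticks to it from then on; so it is constant near
\<open>t\<close>. If \<open>u t = 0\<close>, then \<open>u\<close> is small near \<open>t\<close>, which bounds the distance to the floor.\<close>

lemma slope_at_floor:
  assumes t: "t > 0" "t \<notin> corners" and zt: "z t = - b"
  shows "(z has_real_derivative 0) (at t)" "isCont slope t"
proof -
  have iu: "isCont u t" using u by (simp add: continuous_on_eq_continuous_at)
  have *: "(z has_real_derivative 0) (at t) \<and> isCont slope t"
  proof (cases "u t = 0")
    case True
    have ev: "\<exists>d>0. \<forall>r. \<bar>r - t\<bar> < d \<longrightarrow> \<bar>u r\<bar> < e \<and> r > 0" if "e > 0" for e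
    proof -
      obtain d where "d > 0" "\<And>r. \<bar>r - t\<bar> < d \<Longrightarrow> \<bar>u r\<bar> < e"
        using iu \<open>e > 0\<close> True unfolding continuous_at_eps_delta by (auto simp: dist_real_def)
      then show ?thesis using t by (intro exI[of _ "min d t"]) auto
    qed
    have "(z has_derivative (\<lambda>h. 0)) (at t)"
      unfolding has_derivative_at_alt
    proof (intro conjI allI impI)
      fix e :: real assume "e > 0"
      then obtain d where d: "d > 0" "\<And>r. \<bar>r - t\<bar> < d \<Longrightarrow> \<bar>u r\<bar> < e \<and> r > 0" using ev by blast
      show "\<exists>d>0. \<forall>y. norm (y - t) < d \<longrightarrow> norm (z y - z t - 0) \<le> e * norm (y - t)"
      proof (intro exI[of _ d] conjI allI impI d)
        fix y assume y: "norm (y - t) < d"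
        have "\<bar>z y + b\<bar> \<le> e * \<bar>y - t\<bar>"
        proof (rule z_near_floor)
          show "\<bar>u r\<bar> \<le> e" if "\<bar>r - t\<bar> \<le> \<bar>y - t\<bar>" for r
            using d(2)[of r] that y by auto
        qed (use d(2)[of y] y t zt in auto)
        then show "norm (z y - z t - 0) \<le> e * norm (y - t)" using zt by simp
      qed
    qed simp
    moreover have "isCont slope t"
      unfolding continuous_at_eps_delta
    proof (intro allI impI)
      fix e :: real assume "e > 0"
      then obtain d where d: "d > 0" "\<And>r. \<bar>r - t\<bar> < d \<Longrightarrow> \<bar>u r\<bar> < e \<and> r > 0" using ev by blast
      then show "\<exists>d>0. \<forall>x'. dist x' t < d \<longrightarrow> dist (slope x') (slope t) < e"
        using zt \<open>e > 0\<close> by (intro exI[of _ d]) (auto simp: slope_def dist_real_def)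
    qed
    moreover have "(*) (0::real) = (\<lambda>h. 0)" by auto
    ultimately show ?thesis unfolding has_field_derivative_def by metis
  next
    case False
    then have "u t < 0" using u_nonpos_at_floor[OF t(1) zt] by simp
    then obtain d where d: "d > 0" "\<And>r. \<bar>r - t\<bar> < d \<Longrightarrow> u r < 0"
      using iu[unfolded continuous_at_eps_delta, rule_format, of "- u t"]
      by (fastforce simp: dist_real_def)
    have "\<exists>s. t - min d t < s \<and> s < t \<and> z s \<le> - b"
    proof (rule ccontr)
      assume "\<not> ?thesis"
      then have "\<forall>s. t - min d t < s \<and> s < t \<longrightarrow> z s > - b" by (auto simp: not_le)
      moreover have "min d t > 0" using d t by simp
      ultimately have "t \<in> corners" using t zt unfolding corners_def by blast
      with t show False by simp
    qed
    then obtain s0 where "t - min d t < s0" "s0 < t" "z s0 \<le> - b" by blast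
    then have s0: "t - d < s0" "0 < s0" "s0 < t" "z s0 \<le> - b"
      using min.cobounded1[of d t] min.cobounded2[of d t] by linarith+
    then have "z s0 = - b" using z_ge[of s0] by simp
    have floor: "z s = - b" if "s0 \<le> s" "s < t + d" for s
      by (rule z_sticks[of s0]) (use s0 \<open>z s0 = - b\<close> that in \<open>auto intro!: less_imp_le d(2)\<close>)
    define e where "e = min d (t - s0)"
    have e: "e > 0" "\<And>s. \<bar>s - t\<bar> < e \<Longrightarrow> z s = - b"
      using d s0 floor by (auto simp: e_def)
    have "\<forall>\<^sub>F s in nhds t. z s = - b"
      unfolding eventually_nhds_metric using e by (auto simp: dist_real_def)
    then have "(z has_real_derivative 0) (at t)"
      using DERIV_cong_ev[of t t z "\<lambda>s. - b" 0 0] by simp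
    moreover have "\<forall>\<^sub>F s in nhds t. slope s = (\<lambda>_. 0) s"
      using \<open>\<forall>\<^sub>F s in nhds t. z s = - b\<close> by eventually_elim (simp add: slope_def)
    then have "isCont slope t" using isCont_cong[of slope "\<lambda>_. 0" t] by simp
    ultimately show ?thesis by blast
  qed
  then show "(z has_real_derivative 0) (at t)" "isCont slope t" by auto
qed

lemma slope_deriv:
  assumes "t > 0" "t \<notin> corners"
  shows "(z has_real_derivative slope t) (at t)"
  using slope_at_floor(1)[OF assms] z_deriv_interior[OF assms(1)] z_ge[of t] assms(1)
  by (cases "z t = - b") (auto simp: slope_def)

lemma slope_isCont:
  assumes "t > 0" "t \<notin> corners"
  shows "isCont slope t"
proof (cases "z t = - b")
  case True then show ?thesis using slope_at_floor(2)[OF assms] by blast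
next
  case False
  then have zt: "z t > - b" using z_ge[of t] assms by simp
  have iz: "isCont z t" using z_deriv_interior[OF assms(1) zt] DERIV_isCont by blast
  have "\<forall>\<^sub>F s in nhds t. z s > - b"
    using iz zt unfolding isCont_def tendsto_at_iff_tendsto_nhds by (rule order_tendstoD(1))
  then have "\<forall>\<^sub>F s in nhds t. slope s = u s"
    by eventually_elim (simp add: slope_def)
  moreover have "isCont u t" using u by (simp add: continuous_on_eq_continuous_at)
  ultimately show ?thesis using isCont_cong[of slope u t] by simp
qed

end

section \<open>The Popov inequality for trigonometric sums\<close>

lemma pi_bounds: "3 \<le> pi" "pi < 16 / 5"
proof -
  have "sin (pi / 6) \<le> pi / 6" by (rule sin_x_le_x) auto
  then show "3 \<le> pi" by (simp add: sin_30)
  obtain t :: real where t: "cos (8/5) = (\<Sum>m<4. cos_coeff m * (8/5) ^ m) + cos (t + 1/2 * real 4 * pi) / fact 4 * (8/5) ^ 4"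
    using Maclaurin_cos_expansion2[of "8/5" 4] by auto
  have "(\<Sum>m<4. cos_coeff m * (8/5) ^ m) = 1 - (8/5)^2 / (2::real)"
    by (simp add: lessThan_nat_numeral lessThan_Suc cos_coeff_def fact_numeral power_numeral_reduce)
  moreover have "cos (t + 1/2 * real 4 * pi) / fact 4 * (8/5) ^ 4 \<le> 1 / fact 4 * (8/5) ^ 4"
    by (intro mult_right_mono divide_right_mono cos_le_one) auto
  ultimately have "cos (8/5 :: real) \<le> 1 - (8/5)^2 / 2 + 1 / fact 4 * (8/5) ^ 4"
    unfolding t by linarith
  also have "\<dots> < (0::real)" by (simp add: power_numeral_reduce fact_numeral)
  finally have "cos (8/5 :: real) < 0" .
  moreover have "cos (8/5 :: real) \<ge> 0" if "8/5 \<le> pi/2"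
    using that by (intro cos_ge_zero) auto
  ultimately show "pi < 16 / 5" by force
qed

lemma pi_squared_less: "pi * pi < 2 * pi + 4"
proof -
  have "0 \<le> (pi - 3) * (16 / 5 - pi)" using pi_bounds by simp
  also have "\<dots> = 31 / 5 * pi - 48 / 5 - pi * pi" by (simp add: field_simps)
  finally show ?thesis using pi_bounds by linarith
qed

lemma sin_ge_mult_cos:
  assumes "0 \<le> x" "x \<le> pi"
  shows "x * cos x \<le> sin x"
proof -
  have "sin 0 - 0 * cos 0 \<le> sin x - x * cos x"
  proof (rule DERIV_nonneg_imp_nondecreasing[OF assms(1)])
    fix y assume y: "0 \<le> y" "y \<le> x"
    have "((\<lambda>x. sin x - x * cos x) has_real_derivative y * sin y) (at y)"
      by (auto intro!: derivative_eq_intros)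
    moreover have "y * sin y \<ge> 0" using y assms by (simp add: sin_ge_zero)
    ultimately show "\<exists>d. ((\<lambda>x. sin x - x * cos x) has_real_derivative d) (at y) \<and> d \<ge> 0" by blast
  qed
  then show ?thesis by simp
qed

text \<open>Equality holds at \<open>p = 0\<close> and \<open>p = 1\<close>. After clearing denominators the derivative of the
difference \<open>g\<close> is a quadratic polynomial in \<open>p\<^sup>2\<close> with the roots \<open>1\<close> and \<open>s0\<close>, so \<open>g\<close> increases up
to \<open>sqrt s0\<close> and decreases afterwards; on either side it lies above its end value \<open>0\<close>.\<close>

lemma arctan_lower_bound:
  assumes p: "0 \<le> p" "p \<le> 1"
  shows "pi / 2 * p \<le> arctan p * ((1 + 2 / pi) + (1 - 2 / pi) * p\<^sup>2)"
proof -
  define A B where "A = 1 + 2 / pi" and "B = 1 - 2 / pi"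
  have A: "A > pi / 2"
    using pi_squared_less by (simp add: A_def field_simps)
  have B: "B > 0" using pi_bounds by (simp add: B_def field_simps)
  have AB: "A + B = 2" "pi / 2 * (A - B) = 2" by (simp_all add: A_def B_def field_simps)
  have pos: "A + B * x\<^sup>2 > 0" for x
  proof -
    have "A > 0" using A pi_gt_zero by linarith
    then show ?thesis using B by (intro add_pos_nonneg mult_nonneg_nonneg) auto
  qed
  define g where "g x = arctan x - (pi / 2) * x / (A + B * x\<^sup>2)" for x
  define g' where "g' x = 1 / (1 + x\<^sup>2) - (pi / 2) * (A - B * x\<^sup>2) / (A + B * x\<^sup>2)\<^sup>2" for x
  have der: "(g has_real_derivative g' x) (at x)" for x
  proof -
    have "(g has_real_derivative inverse (1 + x\<^sup>2) -
        (pi / 2 * (A + B * x\<^sup>2) - (pi / 2 * x) * (B * (2 * x))) / ((A + B * x\<^sup>2) * (A + B * x\<^sup>2))) (at x)"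
    proof -
      have 1: "((\<lambda>x. pi / 2 * x) has_real_derivative pi / 2) (at x)"
        by (auto intro!: derivative_eq_intros)
      have 2: "((\<lambda>x. A + B * x\<^sup>2) has_real_derivative B * (2 * x)) (at x)"
        by (auto intro!: derivative_eq_intros)
      show ?thesis unfolding g_def
        by (rule DERIV_diff[OF DERIV_arctan DERIV_divide[OF 1 2]]) (use pos[of x] in simp)
    qed
    moreover have "pi / 2 * (A + B * x\<^sup>2) - (pi / 2 * x) * (B * (2 * x)) = pi / 2 * (A - B * x\<^sup>2)"
      by (simp add: power2_eq_square algebra_simps)
    ultimately show ?thesis
      by (simp only: g'_def power2_eq_square[of "A + B * x\<^sup>2"] inverse_eq_divide)
  qed
  define c where "c = B\<^sup>2 + pi / 2 * B"
  define s0 where "s0 = A * (A - pi / 2) / c"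
  have c: "c > 0" using B by (simp add: c_def add_pos_pos)
  have sgn: "g' x = c * (1 - x\<^sup>2) * (s0 - x\<^sup>2) / ((1 + x\<^sup>2) * (A + B * x\<^sup>2)\<^sup>2)" for x
  proof -
    have cs: "c * s0 = A * (A - pi/2)" using c by (simp add: s0_def)
    have lin: "2 * (A * B) - pi / 2 * (A - B) = - (c + c * s0)"
    proof -
      have "2 * (A * B) - pi / 2 * (A - B) + (c + c * s0) = (A + B)\<^sup>2 - 2 * (pi / 2 * (A - B))"
        unfolding cs unfolding c_def by (simp add: power2_eq_square field_simps)
      also have "\<dots> = 0" by (simp only: AB) simp
      finally show ?thesis by simp
    qed
    define s where "s = x\<^sup>2"
    have "(A + B * s)\<^sup>2 - (pi / 2) * (A - B * s) * (1 + s)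
        = A * (A - pi/2) + (2 * (A * B) - pi / 2 * (A - B)) * s + c * s * s"
      unfolding c_def by (simp add: power2_eq_square field_simps)
    also have "\<dots> = c * (1 - s) * (s0 - s)"
      unfolding lin cs[symmetric] by (simp add: algebra_simps)
    finally have *: "(A + B * s)\<^sup>2 - (pi / 2) * (A - B * s) * (1 + s) = c * (1 - s) * (s0 - s)" .
    have "1 + s > 0" "A + B * s > 0" using pos[of x] by (auto simp: s_def add_pos_nonneg)
    then have "1 / (1 + s) - (pi / 2) * (A - B * s) / (A + B * s)\<^sup>2
        = ((A + B * s)\<^sup>2 - (pi / 2) * (A - B * s) * (1 + s)) / ((1 + s) * (A + B * s)\<^sup>2)"
      by (simp add: divide_simps)
    then show ?thesis unfolding * by (simp add: g'_def s_def)
  qed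
  have den: "(1 + x\<^sup>2) * (A + B * x\<^sup>2)\<^sup>2 > 0" for x
    using pos[of x] by (intro mult_pos_pos) (auto simp: add_pos_nonneg)
  have "g p \<ge> 0"
  proof (cases "p\<^sup>2 \<le> s0")
    case True
    have "g 0 \<le> g p"
    proof (rule DERIV_nonneg_imp_nondecreasing[OF p(1)])
      fix x assume x: "0 \<le> x" "x \<le> p"
      have "x\<^sup>2 \<le> p\<^sup>2" "p\<^sup>2 \<le> 1" using x p by (auto intro: power_mono power_le_one)
      then have "g' x \<ge> 0" unfolding sgn using c den[of x] True
        by (intro divide_nonneg_nonneg mult_nonneg_nonneg) auto
      then show "\<exists>d. (g has_real_derivative d) (at x) \<and> d \<ge> 0" using der by blast
    qed
    then show ?thesis by (simp add: g_def)
  next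
    case False
    have "g 1 \<le> g p"
    proof (rule DERIV_nonpos_imp_nonincreasing[OF p(2)])
      fix x assume x: "p \<le> x" "x \<le> 1"
      have "p\<^sup>2 \<le> x\<^sup>2" "x\<^sup>2 \<le> 1" using x p by (auto intro: power_mono power_le_one)
      then have "g' x \<le> 0" unfolding sgn using c den[of x] False
        by (intro divide_nonpos_pos mult_nonneg_nonpos mult_nonneg_nonneg) auto
      then show "\<exists>d. (g has_real_derivative d) (at x) \<and> d \<le> 0" using der by blast
    qed
    moreover have "g 1 = 0" using AB by (simp add: g_def arctan_one)
    ultimately show ?thesis by simp
  qed
  then have "pi / 2 * p / (A + B * p\<^sup>2) \<le> arctan p" by (simp add: g_def)
  then have "pi / 2 * p \<le> arctan p * (A + B * p\<^sup>2)" using pos_divide_le_eq[OF pos] by blast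
  then show ?thesis by (simp only: A_def B_def)
qed

text \<open>The Popov condition for the delayed integrator \<open>exp (-\<i>\<omega>) / (\<i>\<omega>)\<close> and the sector bound \<open>\<pi>/2\<close>,
with the Popov multiplier \<open>4/\<pi>\<^sup>2\<close>. The inequality is an equality at \<open>\<omega> = \<pi>/2\<close>, and the multiplier is
the one that makes the two sides tangent there. On \<open>[0, \<pi>/2]\<close> the half-angle substitution
\<open>p = tan (\<omega>/2)\<close> leads to the preceding bound on the arctangent; on \<open>[\<pi>/2, 3\<pi>/2]\<close> the inequality
comes from \<open>x cos x \<le> sin x\<close>, and beyond that the right-hand side is at least \<open>1\<close>.\<close>

lemma sin_le_popov:
  assumes \<omega>: "0 \<le> \<omega>"
  shows "sin \<omega> \<le> \<omega> * (2 / pi + 4 / pi\<^sup>2 * cos \<omega>)"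
proof -
  consider "\<omega> \<le> pi / 2" | "pi / 2 \<le> \<omega>" "\<omega> \<le> 3 * pi / 2" | "3 * pi / 2 \<le> \<omega>" by linarith
  then show ?thesis
  proof cases
    case 1
    define a where "a = \<omega> / 2"
    have a: "0 \<le> a" "a \<le> pi / 4" "\<omega> = 2 * a" using 1 \<omega> by (auto simp: a_def)
    have ca: "cos a > 0" using a pi_gt_zero by (intro cos_gt_zero_pi) (auto simp del: pi_gt_zero)
    have at: "arctan (tan a) = a" using a pi_gt_zero by (intro arctan_tan) linarith+
    have t: "0 \<le> tan a" "tan a \<le> 1"
    proof -
      show "0 \<le> tan a" using a ca sin_ge_zero[of a] pi_gt_zero by (simp add: tan_def)
      have "tan a \<le> tan (pi / 4)" using a pi_gt_zero by (intro tan_mono_le) linarith+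
      then show "tan a \<le> 1" by (simp add: tan_45)
    qed
    have "pi / 2 * tan a * (cos a)\<^sup>2 \<le> a * ((1 + 2 / pi) + (1 - 2 / pi) * (tan a)\<^sup>2) * (cos a)\<^sup>2"
      using arctan_lower_bound[OF t] unfolding at by (rule mult_right_mono) simp
    moreover have "tan a * (cos a)\<^sup>2 = sin a * cos a" "(tan a)\<^sup>2 * (cos a)\<^sup>2 = (sin a)\<^sup>2"
      using ca by (simp_all add: tan_def power2_eq_square)
    ultimately have "pi / 2 * (sin a * cos a) \<le> a * ((1 + 2 / pi) * (cos a)\<^sup>2 + (1 - 2 / pi) * (sin a)\<^sup>2)"
      by (simp add: algebra_simps)
    then have "4 / pi * (pi / 2 * (sin a * cos a)) \<le> 4 / pi * (a * ((1 + 2 / pi) * (cos a)\<^sup>2 + (1 - 2 / pi) * (sin a)\<^sup>2))"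
      by (rule mult_left_mono) simp
    also have "\<dots> = 2 * a * (2 / pi * ((sin a)\<^sup>2 + (cos a)\<^sup>2) + 4 / pi\<^sup>2 * ((cos a)\<^sup>2 - (sin a)\<^sup>2))"
    proof -
      have "4 / pi * (a * ((1 + 2 / pi) * x + (1 - 2 / pi) * y)) = 2 * a * (2 / pi * (y + x) + 4 / pi\<^sup>2 * (x - y))" for x y
        by (simp add: field_simps power2_eq_square)
      then show ?thesis .
    qed
    also have "\<dots> = \<omega> * (2 / pi + 4 / pi\<^sup>2 * cos \<omega>)"
      by (simp only: sin_cos_squared_add a(3) cos_double mult_1_right)
    finally have "4 / pi * (pi / 2 * (sin a * cos a)) \<le> \<omega> * (2 / pi + 4 / pi\<^sup>2 * cos \<omega>)" .
    moreover have "4 / pi * (pi / 2 * x) = 2 * x" for x by simp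
    moreover have "sin \<omega> = 2 * (sin a * cos a)" by (simp only: a(3) sin_double mult.assoc)
    ultimately show ?thesis by (simp only:)
  next
    case 2
    define x where "x = (\<omega> - pi / 2) / 2"
    have x: "0 \<le> x" "x \<le> pi / 2" "\<omega> = pi / 2 + 2 * x" using 2 by (auto simp: x_def field_simps)
    have s: "sin \<omega> = cos (2 * x)" "cos \<omega> = - sin (2 * x)"
      using cos_sin_eq[of "- (2 * x)"] sin_cos_eq[of "- (2 * x)"] by (simp_all add: x(3))
    have sx: "sin x \<ge> 0" "cos x \<ge> 0" using x by (auto intro: sin_ge_zero cos_ge_zero)
    have "8 / pi\<^sup>2 \<le> 1"
      using mult_mono[of 3 pi 3 pi] pi_bounds by (simp add: power2_eq_square field_simps)
    then have "8 / pi\<^sup>2 * (x * cos x) \<le> 1 * sin x"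
      using x sx sin_ge_mult_cos[of x] by (intro mult_mono) auto
    then have "8 / pi\<^sup>2 * (x * cos x) * (2 * sin x) \<le> 1 * sin x * (2 * sin x)"
      using sx by (intro mult_right_mono) auto
    then have 1: "4 / pi\<^sup>2 * (2 * x) * sin (2 * x) \<le> 1 - cos (2 * x)"
      unfolding sin_double cos_double_sin by (simp add: power2_eq_square mult_ac)
    have 2: "2 / pi * sin (2 * x) \<le> 2 / pi * (2 * x)"
      using sin_x_le_x[of "2 * x"] x by (intro mult_left_mono) auto
    have "\<omega> * (2 / pi + 4 / pi\<^sup>2 * cos \<omega>) =
        1 + 2 / pi * (2 * x) - 2 / pi * sin (2 * x) - 4 / pi\<^sup>2 * (2 * x) * sin (2 * x)"
    proof -
      have "(pi / 2 + 2 * x) * (2 / pi + 4 / pi\<^sup>2 * (- y)) =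
          1 + 2 / pi * (2 * x) - 2 / pi * y - 4 / pi\<^sup>2 * (2 * x) * y" for y
        by (simp add: field_simps power2_eq_square)
      from this[of "sin (2 * x)"] show ?thesis unfolding s(2) using x(3) by simp
    qed
    then show ?thesis using 1 2 s by linarith
  next
    case 3
    have "1 \<le> 3 * pi / 2 * (2 / pi - 4 / pi\<^sup>2)"
      using pi_bounds by (simp add: field_simps power2_eq_square)
    also have "\<dots> \<le> \<omega> * (2 / pi + 4 / pi\<^sup>2 * cos \<omega>)"
    proof (rule mult_mono[OF 3])
      have "4 / pi\<^sup>2 * (- 1) \<le> 4 / pi\<^sup>2 * cos \<omega>" by (intro mult_left_mono) auto
      then show "2 / pi - 4 / pi\<^sup>2 \<le> 2 / pi + 4 / pi\<^sup>2 * cos \<omega>" by simp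
      show "0 \<le> 2 / pi - 4 / pi\<^sup>2" using pi_bounds by (simp add: field_simps power2_eq_square)
    qed (use \<omega> in auto)
    finally show ?thesis using sin_le_one[of \<omega>] by linarith
  qed
qed

lemma sum_cos_multiples:
  "2 * sin (\<theta> / 2) * (\<Sum>m<n. cos (real m * \<theta>)) = sin (\<theta> / 2) + sin (real n * \<theta> - \<theta> / 2)"
proof (induction n)
  case (Suc n)
  have "sin (real (Suc n) * \<theta> - \<theta> / 2) = sin (real n * \<theta> + \<theta> / 2)"
    by (simp add: algebra_simps)
  then show ?case using Suc
    by (simp add: algebra_simps sin_add sin_diff)
qed simp

text \<open>Up to an error of order \<open>1/n\<close>, uniform in \<open>\<theta>\<close>, the mean of \<open>cos (m\<theta>)\<close> is \<open>sin (n\<theta>) / (n\<theta>)\<close>, to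
which the continuous inequality applies with \<open>\<omega> = n\<theta>\<close>.\<close>

lemma cos_mean_le_popov:
  assumes n: "n > 0" and \<theta>: "0 \<le> \<theta>" "\<theta> \<le> pi"
  shows "(\<Sum>m<n. cos (real m * \<theta>)) / n \<le> 2 / pi + 4 / pi\<^sup>2 * cos (n * \<theta>) + 2 / n"
proof (cases "\<theta> = 0")
  case True
  have "1 \<le> 2 / pi + 4 / pi\<^sup>2" using pi_squared_less by (simp add: field_simps power2_eq_square)
  moreover have "0 \<le> 2 / real n" by simp
  ultimately have "1 \<le> 2 / pi + 4 / pi\<^sup>2 + 2 / real n" by linarith
  then show ?thesis using True n by simp
next
  case False
  define x where "x = \<theta> / 2"
  have x: "0 < x" "x \<le> pi / 2" "\<theta> = 2 * x" using False \<theta> by (auto simp: x_def)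
  define S where "S = (\<Sum>m<n. cos (real m * \<theta>))"
  have sx: "sin x > 0" using x by (intro sin_gt_zero) auto
  have cx: "cos x \<ge> 0" using x by (intro cos_ge_zero) auto
  have "2 * sin x * S = sin x + sin (n * \<theta>) * cos x - cos (n * \<theta>) * sin x"
    using sum_cos_multiples[of \<theta> n] by (simp add: x_def S_def sin_diff)
  then have S: "2 * sin x * (x * S) = x * (sin x + sin (n * \<theta>) * cos x - cos (n * \<theta>) * sin x)"
    by (metis mult.left_commute)
  have "1 - cos x \<le> sin x"
  proof -
    have "sin x * sin x + cos x * cos x \<le> sin x * 1 + cos x * 1"
      using sx cx by (intro add_mono mult_left_mono) auto
    then show ?thesis using sin_cos_squared_add3[of x] by linarith
  qed
  then have "x * (1 - cos x) \<le> x * sin x" using x by simp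
  then have 1: "\<bar>x * cos x - sin x\<bar> \<le> x * sin x"
    using sin_ge_mult_cos[of x] sin_x_le_x[of x] x by (simp add: algebra_simps abs_if)
  have "\<bar>sin (n * \<theta>) * (x * cos x - sin x)\<bar> \<le> 1 * (x * sin x)"
    unfolding abs_mult using 1 by (intro mult_mono) auto
  then have "sin (n * \<theta>) * (x * cos x - sin x) \<le> x * sin x" by linarith
  moreover have "- (cos (n * \<theta>)) * (x * sin x) \<le> 1 * (x * sin x)"
    using x sx cos_ge_minus_one[of "n * \<theta>"] by (intro mult_right_mono) auto
  ultimately have "2 * sin x * (x * S) \<le> sin x * (3 * x + sin (n * \<theta>))"
    unfolding S by (simp add: algebra_simps)
  then have "sin x * (2 * (x * S)) \<le> sin x * (3 * x + sin (n * \<theta>))" by (simp add: algebra_simps)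
  then have "2 * (x * S) \<le> 3 * x + sin (n * \<theta>)" using sx by simp
  also have "\<dots> \<le> 3 * x + (n * \<theta>) * (2 / pi + 4 / pi\<^sup>2 * cos (n * \<theta>))"
    using sin_le_popov[of "n * \<theta>"] \<theta> by simp
  finally have "x * (2 * S) \<le> x * (3 + 2 * n * (2 / pi + 4 / pi\<^sup>2 * cos (n * \<theta>)))"
    by (simp add: x(3) algebra_simps)
  then have "2 * S \<le> 3 + 2 * n * (2 / pi + 4 / pi\<^sup>2 * cos (n * \<theta>))" using x by simp
  then have "2 * S \<le> 4 + 2 * n * (2 / pi + 4 / pi\<^sup>2 * cos (n * \<theta>))" by simp
  then have "S / n \<le> (2 + n * (2 / pi + 4 / pi\<^sup>2 * cos (n * \<theta>))) / n"
    by (intro divide_right_mono) auto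
  also have "\<dots> = 2 / pi + 4 / pi\<^sup>2 * cos (n * \<theta>) + 2 / n"
    using n by (simp add: add_divide_distrib)
  finally show ?thesis by (simp add: S_def)
qed

definition autocorr :: "nat \<Rightarrow> (nat \<Rightarrow> real) \<Rightarrow> nat \<Rightarrow> real" where
  "autocorr M v m = (\<Sum>j<M. \<Sum>k<M. if j = k + m then v j * v k else 0)"

lemma has_integral_cos_multiple:
  "((\<lambda>\<theta>. cos (of_int i * \<theta>)) has_integral (if i = 0 then pi else 0)) {0..pi}"
proof (cases "i = 0")
  case True
  then show ?thesis using has_integral_const_real[of "1::real" 0 pi] by simp
next
  case False
  have "((\<lambda>\<theta>. cos (of_int i * \<theta>)) has_integral (sin (of_int i * pi) / of_int i - sin (of_int i * 0) / of_int i)) {0..pi}"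
    using False by (intro fundamental_theorem_of_calculus)
      (auto intro!: derivative_eq_intros simp flip: has_real_derivative_iff_has_vector_derivative)
  then show ?thesis using False by (simp add: mult.commute[of _ pi] sin_npi_int)
qed

text \<open>The autocorrelation is a Fourier coefficient of a squared modulus. Only finite trigonometric
sums occur, so orthogonality of the cosines replaces Plancherel's theorem.\<close>

lemma has_integral_autocorr:
  "((\<lambda>\<theta>. cos (real m * \<theta>) * ((\<Sum>j<M. v j * cos (real j * \<theta>))\<^sup>2 + (\<Sum>j<M. v j * sin (real j * \<theta>))\<^sup>2))
    has_integral (pi * autocorr M v m)) {0..pi}"
proof -
  have eq: "cos (real m * \<theta>) * ((\<Sum>j<M. v j * cos (real j * \<theta>))\<^sup>2 + (\<Sum>j<M. v j * sin (real j * \<theta>))\<^sup>2)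
     = (\<Sum>j<M. \<Sum>k<M. v j * v k / 2 * (cos (of_int (int m + int j - int k) * \<theta>) + cos (of_int (int m + int k - int j) * \<theta>)))" for \<theta>
  proof -
    have "cos (real m * \<theta>) * ((\<Sum>j<M. v j * cos (real j * \<theta>))\<^sup>2 + (\<Sum>j<M. v j * sin (real j * \<theta>))\<^sup>2)
      = (\<Sum>j<M. \<Sum>k<M. v j * v k * (cos (real m * \<theta>) * (cos (real j * \<theta>) * cos (real k * \<theta>) + sin (real j * \<theta>) * sin (real k * \<theta>))))"
      by (simp add: power2_eq_square sum_product sum.distrib[symmetric] sum_distrib_left algebra_simps)
    also have "\<dots> = (\<Sum>j<M. \<Sum>k<M. v j * v k / 2 * (cos (of_int (int m + int j - int k) * \<theta>) + cos (of_int (int m + int k - int j) * \<theta>)))"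
    proof (intro sum.cong refl)
      fix j k
      have "cos (of_int (int m + int j - int k) * \<theta>) + cos (of_int (int m + int k - int j) * \<theta>)
          = cos (real m * \<theta> + (real j * \<theta> - real k * \<theta>)) + cos (real m * \<theta> - (real j * \<theta> - real k * \<theta>))"
        by (simp add: algebra_simps)
      also have "\<dots> = 2 * (cos (real m * \<theta>) * (cos (real j * \<theta>) * cos (real k * \<theta>) + sin (real j * \<theta>) * sin (real k * \<theta>)))"
        by (simp add: cos_add[of "real m * \<theta>"] cos_diff[of "real m * \<theta>"] cos_diff[of "real j * \<theta>"])
      finally show "v j * v k * (cos (real m * \<theta>) * (cos (real j * \<theta>) * cos (real k * \<theta>) + sin (real j * \<theta>) * sin (real k * \<theta>)))
        = v j * v k / 2 * (cos (of_int (int m + int j - int k) * \<theta>) + cos (of_int (int m + int k - int j) * \<theta>))"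
        by simp
    qed
    finally show ?thesis .
  qed
  have "pi * autocorr M v m = (\<Sum>j<M. \<Sum>k<M. v j * v k / 2 *
      ((if int m + int j - int k = 0 then pi else 0) + (if int m + int k - int j = 0 then pi else 0)))"
  proof -
    have 1: "(\<Sum>j<M. \<Sum>k<M. v j * v k / 2 * (if int m + int k - int j = 0 then pi else 0)) = pi / 2 * autocorr M v m"
      unfolding autocorr_def sum_distrib_left by (intro sum.cong refl) auto
    have "(\<Sum>j<M. \<Sum>k<M. v j * v k / 2 * (if int m + int j - int k = 0 then pi else 0))
        = (\<Sum>k<M. \<Sum>j<M. v j * v k / 2 * (if int m + int j - int k = 0 then pi else 0))"
      by (rule sum.swap)
    also have "\<dots> = pi / 2 * autocorr M v m"
      unfolding autocorr_def sum_distrib_left by (intro sum.cong refl) auto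
    finally show ?thesis using 1 by (simp add: distrib_left sum.distrib)
  qed
  then show ?thesis unfolding eq
    by (simp only:) (intro has_integral_sum has_integral_mult_right has_integral_add has_integral_cos_multiple finite_lessThan)
qed

text \<open>The coefficient inequality on \<open>[0, \<pi>]\<close>, integrated against the nonnegative squared modulus of
the trigonometric sum with coefficients \<open>v\<close>.\<close>

lemma autocorr_mean_le:
  assumes n: "n > 0"
  shows "(\<Sum>m<n. autocorr M v m) / n \<le> (2 / pi + 2 / n) * autocorr M v 0 + 4 / pi\<^sup>2 * autocorr M v n"
proof -
  define V where "V \<theta> = (\<Sum>j<M. v j * cos (real j * \<theta>))\<^sup>2 + (\<Sum>j<M. v j * sin (real j * \<theta>))\<^sup>2" for \<theta>
  note I = has_integral_autocorr[of _ v M, folded V_def]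
  have "((\<lambda>\<theta>. (2 / pi + 2 / n) * (cos (real 0 * \<theta>) * V \<theta>) + 4 / pi\<^sup>2 * (cos (n * \<theta>) * V \<theta>) - (\<Sum>m<n. cos (m * \<theta>) * V \<theta>) / n)
     has_integral ((2 / pi + 2 / n) * (pi * autocorr M v 0) + 4 / pi\<^sup>2 * (pi * autocorr M v n) - (\<Sum>m<n. pi * autocorr M v m) / n)) {0..pi}"
    by (intro has_integral_diff has_integral_add has_integral_mult_right has_integral_divide has_integral_sum I finite_lessThan)
  then have "0 \<le> (2 / pi + 2 / n) * (pi * autocorr M v 0) + 4 / pi\<^sup>2 * (pi * autocorr M v n) - (\<Sum>m<n. pi * autocorr M v m) / n"
  proof (rule has_integral_nonneg)
    fix \<theta> assume \<theta>: "\<theta> \<in> {0..pi}"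
    have "(2 / pi + 2 / n) * (cos (real 0 * \<theta>) * V \<theta>) + 4 / pi\<^sup>2 * (cos (n * \<theta>) * V \<theta>) - (\<Sum>m<n. cos (m * \<theta>) * V \<theta>) / n
       = (2 / pi + 4 / pi\<^sup>2 * cos (n * \<theta>) + 2 / n - (\<Sum>m<n. cos (real m * \<theta>)) / n) * V \<theta>"
      by (simp add: sum_distrib_left algebra_simps)
    also have "\<dots> \<ge> 0"
      using cos_mean_le_popov[OF n, of \<theta>] \<theta> by (intro mult_nonneg_nonneg) (auto simp: V_def)
    finally show "0 \<le> (2 / pi + 2 / n) * (cos (real 0 * \<theta>) * V \<theta>) + 4 / pi\<^sup>2 * (cos (n * \<theta>) * V \<theta>) - (\<Sum>m<n. cos (m * \<theta>) * V \<theta>) / n" .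
  qed
  also have "\<dots> = pi * ((2 / pi + 2 / n) * autocorr M v 0 + 4 / pi\<^sup>2 * autocorr M v n - (\<Sum>m<n. autocorr M v m) / n)"
    by (simp add: sum_distrib_left[symmetric] algebra_simps)
  finally show ?thesis using pi_gt_zero unfolding zero_le_mult_iff by linarith
qed

section \<open>The Popov inequality for signals\<close>

definition grid :: "nat \<Rightarrow> real \<Rightarrow> real" where
  "grid n t = of_int \<lfloor>real n * t\<rfloor> / real n"

lemma grid_tendsto: "(\<lambda>n. grid n t) \<longlonglongrightarrow> t"
proof (rule real_tendsto_sandwich[of "\<lambda>n. t - 1 / real n" _ _ "\<lambda>n. t"])
  have "t - 1 / real n \<le> grid n t \<and> grid n t \<le> t" if "n > 0" for n
  proof -
    have "(real n * t - 1) / n \<le> grid n t" "grid n t \<le> (real n * t) / n"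
      unfolding grid_def by (intro divide_right_mono; linarith)+
    then show ?thesis using that by (simp add: diff_divide_distrib)
  qed
  then show "\<forall>\<^sub>F n in sequentially. t - 1 / real n \<le> grid n t"
    and "\<forall>\<^sub>F n in sequentially. grid n t \<le> t"
    by (auto intro: eventually_mono[OF eventually_gt_at_top[of 0]])
  show "(\<lambda>n. t - 1 / real n) \<longlonglongrightarrow> t"
    using tendsto_diff[OF tendsto_const[of t] lim_1_over_n] by simp
qed simp

lemma grid_measurable [measurable]: "grid n \<in> borel_measurable borel"
  unfolding grid_def by measurable

text \<open>Riemann sums are written as integrals of step functions, so that their limits can be taken by
dominated convergence.\<close>

lemma integral_grid:
  assumes n: "n > 0"
  shows "(\<integral>t. indicator {0..<real P} t * \<phi> (grid n t) \<partial>lborel) = (\<Sum>k<n*P. \<phi> (real k / real n)) / real n"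
proof -
  have eq: "indicator {0..<real P} t * \<phi> (grid n t) =
      (\<Sum>k<n*P. \<phi> (real k / real n) * indicator {real k / n..<real (Suc k) / n} t)" for t
  proof (cases "t \<in> {0..<real P}")
    case True
    define j where "j = nat \<lfloor>real n * t\<rfloor>"
    have j: "real j = of_int \<lfloor>real n * t\<rfloor>" using True by (simp add: j_def)
    have "real n * t < real n * real P" using True n by simp
    then have "real j < real (n * P)" unfolding j using of_int_floor_le[of "real n * t"] by (simp only: of_nat_mult)
    then have jM: "j < n * P" by (simp only: of_nat_less_iff)
    have "(\<Sum>k<n*P. \<phi> (real k / real n) * indicator {real k / n..<real (Suc k) / n} t)
       = (\<Sum>k<n*P. if k = j then \<phi> (real k / real n) else 0)"
    proof (intro sum.cong refl)
      fix k
      have "t \<in> {real k / n..<real (Suc k) / n} \<longleftrightarrow> real k \<le> real n * t \<and> real n * t < real k + 1"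
        using n by (simp add: field_simps)
      also have "\<dots> \<longleftrightarrow> \<lfloor>real n * t\<rfloor> = int k"
        by (simp add: floor_eq_iff)
      also have "\<dots> \<longleftrightarrow> k = j" using j by auto
      finally have "t \<in> {real k / n..<real (Suc k) / n} \<longleftrightarrow> k = j" .
      then show "\<phi> (real k / real n) * indicator {real k / n..<real (Suc k) / n} t = (if k = j then \<phi> (real k / real n) else 0)"
        by (simp add: indicator_def)
    qed
    also have "\<dots> = \<phi> (real j / real n)" using jM by simp
    also have "\<dots> = \<phi> (grid n t)" by (simp add: grid_def j)
    finally show ?thesis using True by simp
  next
    case False
    have "t \<notin> {real k / n..<real (Suc k) / n}" if "k < n * P" for k
    proof
      assume t: "t \<in> {real k / n..<real (Suc k) / n}"
      have "real (Suc k) \<le> real (n * P)" using that by (simp only: of_nat_le_iff)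
      then have "real (Suc k) / n \<le> P" using n by (simp add: field_simps)
      moreover have "0 \<le> real k / n" "real k / n \<le> t" "t < real (Suc k) / n" using t by auto
      ultimately have "0 \<le> t" "t < P" by linarith+
      then show False using False by simp
    qed
    then have "(\<Sum>k<n*P. \<phi> (real k / real n) * indicator {real k / n..<real (Suc k) / n} t) = 0"
      by (intro sum.neutral ballI) (simp only: indicator_simps lessThan_iff not_False_eq_True mult_zero_right)
    then show ?thesis using False by (simp only: indicator_simps not_False_eq_True mult_zero_left)
  qed
  have "(\<integral>t. indicator {0..<real P} t * \<phi> (grid n t) \<partial>lborel) =
      (\<Sum>k<n*P. \<integral>t. \<phi> (real k / real n) * indicator {real k / n..<real (Suc k) / n} t \<partial>lborel)"
    unfolding eq by (rule Bochner_Integration.integral_sum) (auto intro!: integrable_mult_right simp: emeasure_lborel_Ico divide_right_mono)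
  also have "\<dots> = (\<Sum>k<n*P. \<phi> (real k / real n) / real n)"
  proof (intro sum.cong refl)
    fix k
    have "measure lborel {real k / n..<real (Suc k) / n} = 1 / n"
      using n by (simp add: measure_lborel_Ico divide_right_mono field_simps)
    then show "(\<integral>t. \<phi> (real k / real n) * indicator {real k / n..<real (Suc k) / n} t \<partial>lborel) = \<phi> (real k / real n) / real n"
      by simp
  qed
  finally show ?thesis by (simp add: sum_divide_distrib)
qed

lemma tendsto_integral_grid:
  fixes \<psi> :: "nat \<Rightarrow> real \<Rightarrow> real"
  assumes meas: "\<And>n. \<psi> n \<in> borel_measurable borel"
    and bound: "\<And>n t. \<bar>\<psi> n t\<bar> \<le> C"
    and N: "countable N" and lim: "\<And>t. t \<notin> N \<Longrightarrow> (\<lambda>n. \<psi> n t) \<longlonglongrightarrow> g t"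
    and g: "g \<in> borel_measurable borel"
  shows "(\<lambda>n. \<integral>t. indicator {0..<a::real} t * \<psi> n t \<partial>lborel) \<longlonglongrightarrow> (\<integral>t. indicator {0..<a} t * g t \<partial>lborel)"
proof (rule integral_dominated_convergence)
  show "integrable lborel (\<lambda>t. C * indicator {0..<a} t :: real)"
    by (cases "0 \<le> a") (auto intro!: integrable_mult_right simp: emeasure_lborel_Ico)
  have "AE t in lborel. t \<notin> N"
    using N by (intro AE_not_in countable_imp_null_set_lborel)
  then show "AE t in lborel. (\<lambda>n. indicator {0..<a} t * \<psi> n t) \<longlonglongrightarrow> indicator {0..<a} t * g t"
    by eventually_elim (intro tendsto_mult tendsto_const lim)
  show "AE t in lborel. norm (indicator {0..<a} t * \<psi> n t) \<le> C * indicator {0..<a} t" for n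
    using bound by (auto simp: indicator_def)
  show "(\<lambda>t. indicator {0..<a} t * g t) \<in> borel_measurable lborel"
    using g by measurable
  show "(\<lambda>t. indicator {0..<a} t * \<psi> n t) \<in> borel_measurable lborel" for n
    using meas[of n] by measurable
qed

text \<open>The time-domain form of the Popov condition: for a signal \<open>w\<close> with Fourier transform \<open>W\<close>,
the three integrals are, up to a common factor, those of \<open>|W|\<^sup>2\<close> times \<open>sin \<omega> / \<omega>\<close>, \<open>1\<close>
and \<open>cos \<omega>\<close>. The discrete inequality
is applied to the samples \<open>w (k/n)\<close>. As \<open>w\<close> is bounded and continuous off a countable
set, all the sums converge, and the error term of order \<open>1/n\<close> disappears.\<close>

proposition delay_form_le:
  fixes w :: "real \<Rightarrow> real"
  assumes meas [measurable]: "w \<in> borel_measurable borel"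
    and bound: "\<And>t. \<bar>w t\<bar> \<le> C"
    and supp: "\<And>t. t < 0 \<Longrightarrow> w t = 0" "\<And>t. t \<ge> real P \<Longrightarrow> w t = 0"
    and N: "countable N" and cont: "\<And>t. t \<notin> N \<Longrightarrow> isCont w t"
  shows "(\<integral>t. w t * (\<integral>u. indicator {0..<1} u * w (t - u) \<partial>lborel) \<partial>lborel)
    \<le> 2 / pi * (\<integral>t. (w t)\<^sup>2 \<partial>lborel) + 4 / pi\<^sup>2 * (\<integral>t. w t * w (t - 1) \<partial>lborel)"
proof -
  have C: "0 \<le> C" using bound[of 0] by linarith
  define v where "v n k = w (real k / real n)" for n k :: nat
  have ac: "autocorr (n * P) (v n) m = (\<Sum>k<n*P. w (real k / n) * w (real k / n - real m / n))" if "n > 0" for n m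
    unfolding autocorr_def
  proof (intro sum.cong refl)
    fix j assume j: "j \<in> {..<n * P}"
    show "(\<Sum>k<n*P. if j = k + m then v n j * v n k else 0) = w (real j / n) * w (real j / n - real m / n)"
    proof (cases "m \<le> j")
      case True
      have "(\<Sum>k<n*P. if j = k + m then v n j * v n k else 0) = (\<Sum>k<n*P. if k = j - m then v n j * v n k else 0)"
        using True by (intro sum.cong) auto
      also have "\<dots> = v n j * v n (j - m)" using j by (simp add: less_imp_diff_less)
      finally show ?thesis using True by (simp add: v_def of_nat_diff diff_divide_distrib)
    next
      case False
      then have "real j / n - real m / n < 0" using \<open>n > 0\<close> by (simp add: divide_strict_right_mono)
      then show ?thesis using False supp(1) by (auto intro!: sum.neutral)
    qed
  qed
  define I where "I f = (\<integral>t. indicator {0..<real P} t * f t \<partial>lborel)" for f :: "real \<Rightarrow> real"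
  define h where "h n s = (\<integral>u. indicator {0..<1} u * w (s - grid n u) \<partial>lborel)" for n s
  define H where "H s = (\<integral>u. indicator {0..<1} u * w (s - u) \<partial>lborel)" for s
  have I_eq: "I (\<lambda>t. w t * f t) = (\<integral>t. w t * f t \<partial>lborel)" for f
    unfolding I_def
  proof (rule Bochner_Integration.integral_cong[OF refl])
    show "indicator {0..<real P} t * (w t * f t) = w t * f t" for t
      using supp by (cases "t < 0"; cases "t \<ge> real P") auto
  qed
  have hsum: "h n s = (\<Sum>m<n. w (s - real m / n)) / n" if "n > 0" for n s
    using integral_grid[OF that, of 1 "\<lambda>u. w (s - u)"] by (simp add: h_def)
  have ineq: "I (\<lambda>t. w (grid n t) * h n (grid n t)) \<le> (2 / pi + 2 / n) * I (\<lambda>t. w (grid n t) * w (grid n t))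
     + 4 / pi\<^sup>2 * I (\<lambda>t. w (grid n t) * w (grid n t - 1))" if n: "n > 0" for n
  proof -
    have "I (\<lambda>t. w (grid n t) * h n (grid n t)) = (\<Sum>k<n*P. w (real k / n) * h n (real k / n)) / n"
      unfolding I_def by (rule integral_grid[OF n, where \<phi> = "\<lambda>s. w s * h n s"])
    also have "\<dots> = ((\<Sum>m<n. autocorr (n * P) (v n) m) / n) / n"
      unfolding hsum[OF n] ac[OF n] by (subst sum.swap) (simp add: sum_distrib_left sum_divide_distrib)
    also have "\<dots> \<le> ((2 / pi + 2 / n) * autocorr (n * P) (v n) 0 + 4 / pi\<^sup>2 * autocorr (n * P) (v n) n) / n"
      using n by (intro divide_right_mono autocorr_mean_le) auto
    also have "\<dots> = (2 / pi + 2 / n) * (autocorr (n * P) (v n) 0 / n) + 4 / pi\<^sup>2 * (autocorr (n * P) (v n) n / n)"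
      by (simp add: add_divide_distrib)
    also have "autocorr (n * P) (v n) 0 / n = I (\<lambda>t. w (grid n t) * w (grid n t))"
      unfolding I_def ac[OF n] by (subst integral_grid[OF n, where \<phi> = "\<lambda>s. w s * w s"]) simp
    also have "autocorr (n * P) (v n) n / n = I (\<lambda>t. w (grid n t) * w (grid n t - 1))"
      unfolding I_def ac[OF n] using n by (subst integral_grid[OF n, where \<phi> = "\<lambda>s. w s * w (s - 1)"]) simp
    finally show ?thesis .
  qed
  have N1: "countable ((\<lambda>t. t + 1) ` N)" using N by simp
  have wl: "(\<lambda>n. w (grid n t)) \<longlonglongrightarrow> w t" if "t \<notin> N" for t
    using isCont_tendsto_compose[OF cont[OF that] grid_tendsto] .
  have ww: "\<bar>w s * w t\<bar> \<le> C * C" for s t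
    unfolding abs_mult using bound C by (intro mult_mono) auto
  have hl: "(\<lambda>n. h n (grid n t)) \<longlonglongrightarrow> H t" for t
    unfolding h_def H_def
  proof (rule tendsto_integral_grid[where C = C and N = "(\<lambda>s. t - s) ` N"])
    show "(\<lambda>n. w (grid n t - grid n u)) \<longlonglongrightarrow> w (t - u)" if "u \<notin> (\<lambda>s. t - s) ` N" for u
    proof (rule isCont_tendsto_compose[OF cont tendsto_diff[OF grid_tendsto grid_tendsto]])
      show "t - u \<notin> N" using that by (metis diff_diff_eq2 add_diff_cancel_left' imageI)
    qed
  qed (use bound N in auto)
  have hb: "\<bar>h n s\<bar> \<le> C" if "n > 0" for n s
  proof -
    have "\<bar>\<Sum>m<n. w (s - real m / n)\<bar> \<le> (\<Sum>m<n. C)"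
      by (intro order_trans[OF sum_abs] sum_mono bound)
    then show ?thesis unfolding hsum[OF that] using that by (simp add: field_simps)
  qed
  have h0: "h 0 s = w s" for s by (simp add: h_def grid_def)
  then have hb': "\<bar>h n s\<bar> \<le> C" for n s using hb[of n s] bound[of s] by (cases "n = 0") auto
  have hm: "h n \<in> borel_measurable borel" for n
  proof (cases "n = 0")
    case True then show ?thesis using h0 by (simp add: measurable_cong[of borel "h 0" w])
  next
    case False then show ?thesis by (subst measurable_cong[OF hsum]) auto
  qed
  have Hm: "H \<in> borel_measurable borel"
    unfolding H_def by measurable
  have L1: "(\<lambda>n. I (\<lambda>t. w (grid n t) * w (grid n t))) \<longlonglongrightarrow> I (\<lambda>t. w t * w t)"
    unfolding I_def by (rule tendsto_integral_grid[where C = "C * C" and N = N])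
      (use ww order_trans[OF abs_ge_self ww] N in \<open>auto intro!: tendsto_mult wl\<close>)
  have L2: "(\<lambda>n. I (\<lambda>t. w (grid n t) * w (grid n t - 1))) \<longlonglongrightarrow> I (\<lambda>t. w t * w (t - 1))"
    unfolding I_def
  proof (rule tendsto_integral_grid[where C = "C * C" and N = "N \<union> (\<lambda>t. t + 1) ` N"])
    show "(\<lambda>n. w (grid n t) * w (grid n t - 1)) \<longlonglongrightarrow> w t * w (t - 1)" if t: "t \<notin> N \<union> (\<lambda>t. t + 1) ` N" for t
    proof (intro tendsto_mult wl isCont_tendsto_compose[OF cont tendsto_diff[OF grid_tendsto tendsto_const]])
      show "t - 1 \<notin> N" using t by (metis UnI2 diff_add_cancel imageI)
    qed (use t in auto)
  qed (use ww N N1 in auto)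
  have L3: "(\<lambda>n. I (\<lambda>t. w (grid n t) * h n (grid n t))) \<longlonglongrightarrow> I (\<lambda>t. w t * H t)"
    unfolding I_def
  proof (rule tendsto_integral_grid[where C = "C * C" and N = N])
    show "\<bar>w (grid n t) * h n (grid n t)\<bar> \<le> C * C" for n t
      unfolding abs_mult using bound hb' C by (intro mult_mono) auto
    show "(\<lambda>t. w (grid n t) * h n (grid n t)) \<in> borel_measurable borel" for n
      using hm[of n] by measurable
    show "(\<lambda>t. w t * H t) \<in> borel_measurable borel"
      using Hm by measurable
  qed (use N in \<open>auto intro!: tendsto_mult wl hl\<close>)
  have "(\<lambda>n. 2 / real n) \<longlonglongrightarrow> 0"
    using tendsto_mult_right_zero[OF lim_1_over_n, of 2] by simp
  then have "(\<lambda>n. (2 / pi + 2 / real n) * I (\<lambda>t. w (grid n t) * w (grid n t))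
     + 4 / pi\<^sup>2 * I (\<lambda>t. w (grid n t) * w (grid n t - 1))) \<longlonglongrightarrow>
      (2 / pi + 0) * I (\<lambda>t. w t * w t) + 4 / pi\<^sup>2 * I (\<lambda>t. w t * w (t - 1))"
    by (intro tendsto_intros L1 L2)
  then have "I (\<lambda>t. w t * H t) \<le> (2 / pi + 0) * I (\<lambda>t. w t * w t) + 4 / pi\<^sup>2 * I (\<lambda>t. w t * w (t - 1))"
    by (rule LIMSEQ_le[OF L3]) (use ineq in \<open>auto intro!: exI[of _ 1]\<close>)
  then show ?thesis by (simp add: I_eq H_def power2_eq_square)
qed

section \<open>The normalized equation and the Popov integral\<close>

lemma bounded_borel_integral:
  fixes g :: "real \<Rightarrow> real"
  assumes g [measurable]: "g \<in> borel_measurable borel" and bound: "\<And>t. \<bar>g t\<bar> \<le> C"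
  shows "g integrable_on {a..b}"
    and "(\<integral>t. indicator {a..b} t * g t \<partial>lborel) = integral {a..b} g"
proof -
  have "set_integrable lborel {a..b} g"
    unfolding set_integrable_def
  proof (rule Bochner_Integration.integrable_bound)
    show "integrable lborel (\<lambda>t. C * indicator {a..b} t :: real)"
      by (cases "a \<le> b") (auto intro!: integrable_mult_right simp: emeasure_lborel_Icc)
    show "AE t in lborel. norm (indicator {a..b} t *\<^sub>R g t) \<le> norm (C * indicator {a..b} t)"
      using bound order_trans[OF bound abs_ge_self] by (auto simp: indicator_def)
  qed measurable
  from set_borel_integral_eq_integral[OF this]
  show "g integrable_on {a..b}"
    and "(\<integral>t. indicator {a..b} t * g t \<partial>lborel) = integral {a..b} g"
    by (auto simp: set_lebesgue_integral_def)
qed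

text \<open>A monotonicity criterion for functions that may jump upwards: a lower bound on the right Dini
derivative at every point, and no downward jump from the left.\<close>

lemma monotone_by_dini:
  fixes \<phi> :: "real \<Rightarrow> real"
  assumes "a \<le> b"
    and right: "\<And>t e. a \<le> t \<Longrightarrow> t < b \<Longrightarrow> e > 0 \<Longrightarrow> \<exists>d>0. \<forall>r. t < r \<and> r < t + d \<longrightarrow> \<phi> t - e * (r - t) \<le> \<phi> r"
    and left: "\<And>t e. a < t \<Longrightarrow> t \<le> b \<Longrightarrow> e > 0 \<Longrightarrow> \<exists>d>0. \<forall>r. a \<le> r \<and> t - d < r \<and> r < t \<longrightarrow> \<phi> r \<le> \<phi> t + e"
  shows "\<phi> a \<le> \<phi> b"
proof (rule field_le_epsilon)
  fix e :: real assume "e > 0"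
  define e1 where "e1 = e / (b - a + 1)"
  have e1: "e1 > 0" using \<open>e > 0\<close> \<open>a \<le> b\<close> by (simp add: e1_def)
  define S where "S = {t. a \<le> t \<and> t \<le> b \<and> (\<forall>r. a \<le> r \<and> r \<le> t \<longrightarrow> \<phi> a - e1 * (r - a) \<le> \<phi> r)}"
  have aS: "a \<in> S" using \<open>a \<le> b\<close> by (auto simp: S_def)
  have bdd: "bdd_above S" by (auto simp: S_def intro!: bdd_aboveI[of _ b])
  define \<sigma> where "\<sigma> = Sup S"
  have "a \<le> \<sigma>" unfolding \<sigma>_def by (rule cSup_upper[OF aS bdd])
  moreover have "\<sigma> \<le> b" unfolding \<sigma>_def
    by (rule cSup_least) (use aS in blast, simp add: S_def)
  ultimately have \<sigma>: "a \<le> \<sigma>" "\<sigma> \<le> b" by auto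
  have below: "\<phi> a - e1 * (r - a) \<le> \<phi> r" if r: "a \<le> r" "r < \<sigma>" for r
  proof -
    obtain t where "t \<in> S" "r < t"
      using less_cSup_iff[of S r] aS bdd r unfolding \<sigma>_def by blast
    then show ?thesis using r unfolding S_def by simp
  qed
  have at: "\<phi> a - e1 * (\<sigma> - a) \<le> \<phi> \<sigma>"
  proof (cases "\<sigma> = a")
    case False
    then have "a < \<sigma>" using \<sigma> by simp
    show ?thesis
    proof (rule field_le_epsilon)
      fix h :: real assume "h > 0"
      then obtain d where d: "d > 0" "\<And>r. a \<le> r \<Longrightarrow> \<sigma> - d < r \<Longrightarrow> r < \<sigma> \<Longrightarrow> \<phi> r \<le> \<phi> \<sigma> + h"
        using left[OF \<open>a < \<sigma>\<close> \<sigma>(2)] by blast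
      obtain r where r: "max a (\<sigma> - d) < r" "r < \<sigma>"
        using dense[of "max a (\<sigma> - d)" \<sigma>] \<open>a < \<sigma>\<close> d by auto
      have "e1 * (r - a) \<le> e1 * (\<sigma> - a)" using r e1 by (intro mult_left_mono) auto
      then show "\<phi> a - e1 * (\<sigma> - a) \<le> \<phi> \<sigma> + h"
        using d(2)[of r] below[of r] r by simp
    qed
  qed simp
  have \<sigma>S: "\<sigma> \<in> S" using \<sigma> at below unfolding S_def mem_Collect_eq by (metis le_less)
  have "\<sigma> = b"
  proof (rule ccontr)
    assume "\<sigma> \<noteq> b"
    then have "\<sigma> < b" using \<sigma> by simp
    then obtain d where d: "d > 0" "\<And>r. \<sigma> < r \<Longrightarrow> r < \<sigma> + d \<Longrightarrow> \<phi> \<sigma> - e1 * (r - \<sigma>) \<le> \<phi> r"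
      using right[OF \<sigma>(1) _ e1] by blast
    obtain t where t: "\<sigma> < t" "t < min b (\<sigma> + d)"
      using dense[of \<sigma> "min b (\<sigma> + d)"] d \<open>\<sigma> < b\<close> by auto
    have "\<phi> a - e1 * (r - a) \<le> \<phi> r" if "a \<le> r" "r \<le> t" for r
    proof (cases "r \<le> \<sigma>")
      case True then show ?thesis using \<sigma>S that unfolding S_def by simp
    next
      case False
      then have "\<phi> \<sigma> - e1 * (r - \<sigma>) \<le> \<phi> r" using d(2)[of r] that t by simp
      then show ?thesis using at by (simp add: algebra_simps)
    qed
    then have "t \<in> S" using t \<sigma> unfolding S_def by simp
    then have "t \<le> \<sigma>" unfolding \<sigma>_def by (rule cSup_upper[OF _ bdd])
    with t show False by simp
  qed
  with at have "\<phi> a \<le> \<phi> b + e1 * (b - a)" by simp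
  also have "e1 * (b - a) \<le> e" using \<open>e > 0\<close> \<open>a \<le> b\<close> by (simp add: e1_def field_simps)
  finally show "\<phi> a \<le> \<phi> b + e" by simp
qed

lemma exp_chord:
  fixes x L :: real
  assumes "0 \<le> x" "x \<le> L" "L > 0"
  shows "exp x - 1 \<le> x * ((exp L - 1) / L)"
proof -
  have "exp ((1 - x / L) *\<^sub>R 0 + (x / L) *\<^sub>R L) \<le> (1 - x / L) * exp 0 + (x / L) * exp L"
    using assms by (intro convex_onD[OF exp_convex]) auto
  then have "exp x \<le> (1 - x / L) + (x / L) * exp L" using assms by simp
  then show ?thesis by (simp add: diff_divide_distrib right_diff_distrib)
qed

text \<open>A solution in the normalized variables: the delay is \<open>1\<close> and the floor is \<open>-L\<close>. Having
\<open>y\<close> continuous on the whole line avoids relativizing the forcing term to an interval.\<close>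

locale delayed_reflection =
  fixes a L :: real and y U :: "real \<Rightarrow> real"
  assumes a: "a > 0" and L: "L > 0"
    and cont_y: "continuous_on UNIV y"
    and y_ge: "\<And>t. y t \<ge> - L"
    and U_0: "U 0 = 0"
    and U_deriv: "\<And>t. (U has_real_derivative a * (exp (- y (t - 1)) - 1)) (at t)"
    and y_reflected: "\<And>t. t \<ge> 0 \<Longrightarrow> y t = reflected L (y 0) U t"
begin

definition f :: "real \<Rightarrow> real" where "f v = a * (1 - exp (- v))"

definition F :: "real \<Rightarrow> real" where "F v = a * (v + exp (- v) - 1)"

definition s :: "real \<Rightarrow> real" where "s t = (if y t > - L then - f (y (t - 1)) else 0)"

text \<open>\<open>K\<close> bounds \<open>f\<close> on the range of \<open>y\<close>; \<open>k\<close> is the slope of the chord of \<open>f\<close> from \<open>-L\<close> to \<open>0\<close>.\<close>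

definition K :: real where "K = a * exp L"

definition k :: real where "k = a * ((exp L - 1) / L)"

lemma F_deriv: "(F has_real_derivative f v) (at v)"
  unfolding F_def f_def by (auto intro!: derivative_eq_intros)

lemma f_deriv: "(f has_real_derivative a * exp (- v)) (at v)"
  unfolding f_def by (auto intro!: derivative_eq_intros)

lemma cont_f: "continuous_on A f"
  unfolding f_def by (intro continuous_intros)

lemma F_nonneg: "F v \<ge> 0"
  using exp_ge_add_one_self[of "- v"] a by (simp add: F_def)

lemma F_le: "F v \<le> v * f v"
proof -
  have "(1 + v) * exp (- v) \<le> exp v * exp (- v)"
    by (intro mult_right_mono exp_ge_add_one_self) auto
  then have "v + exp (- v) - 1 \<le> v * (1 - exp (- v))"
    by (simp add: exp_minus algebra_simps)
  then have "a * (v + exp (- v) - 1) \<le> a * (v * (1 - exp (- v)))"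
    using a by (intro mult_left_mono) auto
  then show ?thesis by (simp add: F_def f_def algebra_simps)
qed

lemma f_mono: "u \<le> v \<Longrightarrow> f u \<le> f v"
  using a by (simp add: f_def)

lemma f_pos: "v > 0 \<Longrightarrow> f v > 0" and f_neg: "v < 0 \<Longrightarrow> f v < 0"
  using a by (auto simp: f_def mult_pos_neg)

lemma f_abs_le: "\<bar>v\<bar> \<le> \<eta> \<Longrightarrow> \<bar>f v\<bar> \<le> a * (exp \<eta> - 1)"
proof -
  assume v: "\<bar>v\<bar> \<le> \<eta>"
  have "exp (- v) \<le> exp \<eta>" "exp (- \<eta>) \<le> exp (- v)" using v by auto
  moreover have "1 - exp (- \<eta>) \<le> exp \<eta> - 1"
    using exp_ge_add_one_self[of "- \<eta>"] exp_ge_add_one_self[of \<eta>] by linarith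
  ultimately have "\<bar>1 - exp (- v)\<bar> \<le> exp \<eta> - 1" by linarith
  then show ?thesis using a by (simp add: f_def abs_mult)
qed

lemma f_bound: "v \<ge> - L \<Longrightarrow> \<bar>f v\<bar> \<le> K"
proof -
  assume "v \<ge> - L"
  then have "exp (- v) \<le> exp L" by simp
  moreover have "exp L \<ge> 1" using L by simp
  ultimately have "\<bar>1 - exp (- v)\<bar> \<le> exp L" using exp_gt_zero[of "- v"] by linarith
  then show ?thesis using a by (simp add: f_def K_def abs_mult)
qed

lemma K_nonneg: "K \<ge> 0" using a by (simp add: K_def)

lemma k_pos: "k > 0" using a L by (simp add: k_def)

text \<open>Since \<open>f\<close> is concave, its chords from the origin are steepest at the left end \<open>-L\<close> of the range.
This is where the floor helps: without it the nonlinearity has no sector bound.\<close>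

lemma sector: "v \<ge> - L \<Longrightarrow> (f v)\<^sup>2 \<le> k * (v * f v)"
proof -
  assume v: "v \<ge> - L"
  show ?thesis
  proof (cases "v \<ge> 0")
    case True
    have "f v \<le> a * v" using exp_ge_add_one_self[of "- v"] a by (simp add: f_def)
    also have "\<dots> \<le> k * v"
    proof (rule mult_right_mono[OF _ True])
      have "1 \<le> (exp L - 1) / L" using exp_ge_add_one_self[of L] L by (simp add: field_simps)
      then show "a \<le> k" using mult_left_mono[of 1 "(exp L - 1) / L" a] a by (simp add: k_def)
    qed
    finally have "f v \<le> k * v" .
    moreover have "f v \<ge> 0" using True a by (simp add: f_def)
    ultimately have "f v * f v \<le> k * v * f v" by (intro mult_right_mono) auto
    then show ?thesis by (simp add: power2_eq_square mult_ac)
  next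
    case False
    have "a * (exp (- v) - 1) \<le> a * (- v * ((exp L - 1) / L))"
      using exp_chord[of "- v" L] False v L a by (intro mult_left_mono) auto
    moreover have "k * v = - (a * (- v * ((exp L - 1) / L)))" by (simp add: k_def)
    moreover have "f v = - (a * (exp (- v) - 1))" by (simp add: f_def algebra_simps)
    ultimately have "k * v \<le> f v" by linarith
    moreover have "f v \<le> 0" using False a by (simp add: f_def mult_nonneg_nonpos)
    ultimately have "f v * f v \<le> k * v * f v" by (intro mult_right_mono_neg) auto
    then show ?thesis by (simp add: power2_eq_square mult_ac)
  qed
qed

sublocale path: reflected_path L "y 0" "\<lambda>t. - f (y (t - 1))" U
proof
  show "continuous_on UNIV (\<lambda>t. - f (y (t - 1)))"
    by (intro continuous_intros continuous_on_compose2[OF cont_f] continuous_on_compose2[OF cont_y]) auto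
  show "(U has_real_derivative - f (y (t - 1))) (at t)" for t
    using U_deriv[of t] by (simp add: f_def algebra_simps)
qed (use U_0 y_ge in auto)

lemma path_eq: "t \<ge> 0 \<Longrightarrow> reflected L (y 0) U t = y t"
  by (rule y_reflected[symmetric])

lemma y_deriv:
  assumes "t > 0" "t \<notin> path.corners"
  shows "(y has_real_derivative s t) (at t)"
proof (rule has_field_derivative_transform_within_open)
  show "(reflected L (y 0) U has_real_derivative s t) (at t)"
    using path.slope_deriv[OF assms] path_eq[of t] assms by (simp add: path.slope_def s_def)
  show "reflected L (y 0) U x = y x" if "x \<in> {0<..}" for x using path_eq[of x] that by simp
qed (use assms in auto)

lemma s_isCont:
  assumes "t > 0" "t \<notin> path.corners"
  shows "isCont s t"
proof -
  have "\<forall>\<^sub>F x in nhds t. x \<in> {0<..}"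
    using assms by (intro eventually_nhds_in_open) auto
  then have "\<forall>\<^sub>F x in nhds t. s x = path.slope x"
    by eventually_elim (use path_eq in \<open>simp add: path.slope_def s_def\<close>)
  then show ?thesis using path.slope_isCont[OF assms] isCont_cong by blast
qed

lemma s_bound: "\<bar>s t\<bar> \<le> K"
  using f_bound[OF y_ge] K_nonneg by (simp add: s_def)

lemma y_lipschitz: "0 \<le> r \<Longrightarrow> r \<le> t \<Longrightarrow> \<bar>y t - y r\<bar> \<le> K * (t - r)"
  using path.z_lipschitz[of r t K] f_bound[OF y_ge] path_eq by simp

lemma y_measurable [measurable]: "y \<in> borel_measurable borel"
  by (rule borel_measurable_continuous_onI[OF cont_y])

lemma f_measurable [measurable]: "f \<in> borel_measurable borel"
  by (rule borel_measurable_continuous_onI[OF cont_f])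

lemma s_measurable [measurable]: "s \<in> borel_measurable borel"
  unfolding s_def by measurable

lemma y_bounded_on: "\<exists>B. \<forall>x\<in>{r..t}. \<bar>y x\<bar> \<le> B"
proof -
  have "compact (y ` {r..t})"
    by (intro compact_continuous_image continuous_on_subset[OF cont_y]) auto
  then have "bounded (y ` {r..t})" by (rule compact_imp_bounded)
  then show ?thesis by (auto simp: bounded_iff)
qed

text \<open>The path is Lipschitz continuous and differentiable off a countable set, which is enough for the
chain rule in integrated form.\<close>

lemma chain_integral:
  assumes G: "\<And>v. (G has_real_derivative G' v) (at v)" and G': "continuous_on UNIV G'"
    and rt: "0 \<le> r" "r \<le> t"
  shows "((\<lambda>x. G' (y x) * s x) has_integral G (y t) - G (y r)) {r..t}"
proof (rule has_integral_abs_continuous[OF rt(2), where N = "insert 0 path.corners"])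
  obtain B where B: "\<And>x. x \<in> {r..t} \<Longrightarrow> \<bar>y x\<bar> \<le> B" using y_bounded_on by blast
  have "compact (G' ` {-B..B})"
    by (intro compact_continuous_image continuous_on_subset[OF G']) auto
  then have "bounded (G' ` {-B..B})" by (rule compact_imp_bounded)
  then obtain M where "\<forall>x\<in>G' ` {-B..B}. norm x \<le> M" unfolding bounded_iff by blast
  then have M: "\<And>v. v \<in> {-B..B} \<Longrightarrow> \<bar>G' v\<bar> \<le> M" by auto
  show "abs_continuous_on {r..t} (\<lambda>x. G (y x))"
  proof (rule abs_continuous_on_lipschitz)
    fix p q assume pq: "p \<in> {r..t}" "q \<in> {r..t}" "p \<le> q"
    have yB: "y p \<in> {-B..B}" "y q \<in> {-B..B}" using B[OF pq(1)] B[OF pq(2)] by auto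
    have "norm (G (y q) - G (y p)) \<le> M * norm (y q - y p)"
    proof (rule field_differentiable_bound[where S = "{-B..B}" and f' = G'])
      show "(G has_field_derivative G' z) (at z within {-B..B})" for z
        using G DERIV_subset by blast
    qed (use M yB in auto)
    also have "\<dots> \<le> M * (K * (q - p))"
      using y_lipschitz[of p q] pq rt M[OF yB(1)] by (intro mult_left_mono) auto
    finally show "\<bar>G (y q) - G (y p)\<bar> \<le> (M * K) * (q - p)" by (simp add: mult.assoc)
  qed
  show "negligible (insert 0 path.corners)"
    using path.countable_corners by (intro negligible_countable) simp
  show "((\<lambda>x. G (y x)) has_real_derivative G' (y x) * s x) (at x within {r..t})"
    if "x \<in> {r..t} - insert 0 path.corners" for x
    using DERIV_chain2[OF G y_deriv[of x]] that rt by (auto intro: DERIV_subset)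
qed

lemma y_integral: "0 \<le> r \<Longrightarrow> r \<le> t \<Longrightarrow> (s has_integral y t - y r) {r..t}"
  using chain_integral[of "\<lambda>v. v" "\<lambda>_. 1" r t] by simp

lemma y_squared_integral: "0 \<le> r \<Longrightarrow> r \<le> t \<Longrightarrow> ((\<lambda>x. s x * y x) has_integral ((y t)\<^sup>2 - (y r)\<^sup>2) / 2) {r..t}"
proof -
  assume rt: "0 \<le> r" "r \<le> t"
  have "((\<lambda>v. v\<^sup>2 / 2) has_real_derivative v) (at v)" for v :: real
    by (auto intro!: derivative_eq_intros)
  from chain_integral[OF this continuous_on_id rt] show ?thesis
    by (simp add: mult.commute diff_divide_distrib)
qed

lemma delayed_product_integrable: "(\<lambda>x. s x * s (x - 1)) integrable_on {r..t}"
proof (rule bounded_borel_integral)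
  show "\<bar>s x * s (x - 1)\<bar> \<le> K * K" for x
    unfolding abs_mult using s_bound K_nonneg by (intro mult_mono) auto
qed measurable

lemma delayed_product_small:
  assumes "r \<le> t" "\<And>x. r \<le> x \<Longrightarrow> x \<le> t \<Longrightarrow> \<bar>f (y (x - 1))\<bar> \<le> e" "0 \<le> e"
  shows "\<bar>integral {r..t} (\<lambda>x. s x * s (x - 1))\<bar> \<le> K * e * (t - r)"
proof -
  have "norm (integral {r..t} (\<lambda>x. s x * s (x - 1))) \<le> e * K * (t - r)"
  proof (rule has_integral_bound_real[OF _ finite.emptyI integrable_integral[OF delayed_product_integrable], THEN order_trans])
    show "norm (s x * s (x - 1)) \<le> e * K" if "x \<in> {r..t} - {}" for x
      unfolding real_norm_def abs_mult using that assms s_bound K_nonneg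
      by (intro mult_mono) (auto simp: s_def)
  qed (use assms K_nonneg in auto)
  then show ?thesis by (simp add: mult_ac)
qed

lemma delayed_product_free:
  assumes r: "1 \<le> r" "r \<le> t" and free: "\<And>x. r \<le> x \<Longrightarrow> x \<le> t \<Longrightarrow> y x > - L"
  shows "integral {r..t} (\<lambda>x. s x * s (x - 1)) = F (y (r - 1)) - F (y (t - 1))"
proof -
  have "((\<lambda>x. f (y x) * s x) has_integral F (y (t - 1)) - F (y (r - 1))) {r - 1..t - 1}"
    using r by (intro chain_integral F_deriv cont_f) auto
  from has_integral_neg[OF has_integral_shift_real_ivl[OF this, of "- 1"]]
  have "((\<lambda>x. - (f (y (x - 1)) * s (x - 1))) has_integral - (F (y (t - 1)) - F (y (r - 1)))) {r..t}"
    by simp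
  then have "((\<lambda>x. s x * s (x - 1)) has_integral - (F (y (t - 1)) - F (y (r - 1)))) {r..t}"
  proof (rule has_integral_eq[rotated])
    fix x assume "x \<in> {r..t}"
    then have "s x = - f (y (x - 1))" using free[of x] by (simp add: s_def)
    then show "- (f (y (x - 1)) * s (x - 1)) = s x * s (x - 1)" by simp
  qed
  then show ?thesis by (simp add: integral_unique)
qed

text \<open>Away from the floor \<open>s x = - f (y (x - 1))\<close>, so \<open>- s x * s (x - 1)\<close> is the derivative of
\<open>F (y (x - 1))\<close>, and without reflection the integral telescopes. With reflection, the potential
\<open>R\<close> is reset to \<open>0\<close> while the path is on the floor. When the path hits the floor, \<open>R\<close> drops,
which has the favourable sign. When it leaves the floor, the forcing vanishes, so the delayed
value is \<open>0\<close> and \<open>R\<close> starts again continuously from \<open>F 0 = 0\<close>. As there can be infinitely many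
excursions, the pieces are assembled by the Dini criterion instead of a sum.\<close>

lemma popov_integral:
  assumes T: "1 \<le> T"
  shows "integral {1..T} (\<lambda>x. s x * s (x - 1)) \<le> F (y 0)"
proof -
  define I where "I t = integral {1..t} (\<lambda>x. s x * s (x - 1))" for t
  define R where "R t = (if y t > - L then F (y (t - 1)) else 0)" for t
  have I_diff: "I t - I r = integral {r..t} (\<lambda>x. s x * s (x - 1))" if "1 \<le> r" "r \<le> t" for r t
    using Henstock_Kurzweil_Integration.integral_combine[of 1 r t "\<lambda>x. s x * s (x - 1)"] that delayed_product_integrable
    by (simp add: I_def)
  have R_nonneg: "0 \<le> R t" "R t \<le> F (y (t - 1))" for t using F_nonneg by (auto simp: R_def)
  have cy: "isCont y t" for t using cont_y by (simp add: continuous_on_eq_continuous_at)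
  have local_const: "\<exists>d>0. \<forall>r. 1 \<le> r \<and> \<bar>r - t\<bar> < d \<longrightarrow> - I r - R r = - I t - R t" if t: "1 \<le> t" "y t > - L" for t
  proof -
    have "y t + L > 0" using t by simp
    then obtain d where d: "d > 0" "\<And>r. \<bar>r - t\<bar> < d \<Longrightarrow> \<bar>y r - y t\<bar> < y t + L"
      using cy[of t] unfolding continuous_at_eps_delta dist_real_def by blast
    have free: "y r > - L" if "\<bar>r - t\<bar> < d" for r using d(2)[OF that] by linarith
    have "- I q - R q = - I p - R p" if "1 \<le> p" "p \<le> q" "\<bar>p - t\<bar> < d" "\<bar>q - t\<bar> < d" for p q
      using delayed_product_free[of p q] I_diff[of p q] free that by (simp add: R_def abs_less_iff)
    note const = this
    have "- I r - R r = - I t - R t" if "1 \<le> r" "\<bar>r - t\<bar> < d" for r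
      using const[of r t] const[of t r] t d(1) that by (cases "r \<le> t") auto
    then show ?thesis using d(1) by blast
  qed
  have "- I 1 - R 1 \<le> - I T - R T"
  proof (rule monotone_by_dini[OF T])
    fix t e :: real assume t: "1 \<le> t" "t < T" and e: "e > 0"
    show "\<exists>d>0. \<forall>r. t < r \<and> r < t + d \<longrightarrow> - I t - R t - e * (r - t) \<le> - I r - R r"
    proof (cases "y t > - L")
      case True
      then obtain d where d: "d > 0" "\<And>r. 1 \<le> r \<Longrightarrow> \<bar>r - t\<bar> < d \<Longrightarrow> - I r - R r = - I t - R t"
        using local_const t by blast
      show ?thesis
      proof (intro exI[of _ d] conjI allI impI d(1))
        fix r assume r: "t < r \<and> r < t + d"
        then have "0 \<le> e * (r - t)" using e by simp
        then show "- I t - R t - e * (r - t) \<le> - I r - R r" using d(2)[of r] r t by simp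
      qed
    next
      case False
      then have yt: "y t = - L" using y_ge[of t] by simp
      then have "f (y (t - 1)) \<ge> 0" using path.u_nonpos_at_floor[of t] path_eq[of t] t by simp
      have cf: "isCont (\<lambda>r. f (y (r - 1))) t"
        by (intro continuous_intros isCont_o2[OF _ DERIV_isCont[OF f_deriv]] isCont_o2[OF _ cy])
      \<comment> \<open>If the forcing vanishes, \<open>e1\<close> makes both \<open>I\<close> and \<open>R\<close> vary by at most \<open>e / 2\<close> per unit of time; otherwise it keeps the forcing negative, so that the path sticks to the floor.\<close>
      define e1 where "e1 = (if f (y (t - 1)) = 0 then e / (2 * (K + 1)) else f (y (t - 1)))"
      have e1: "e1 > 0" using \<open>f (y (t - 1)) \<ge> 0\<close> e K_nonneg by (auto simp: e1_def)
      then obtain d where d: "d > 0" "\<And>r. \<bar>r - t\<bar> < d \<Longrightarrow> \<bar>f (y (r - 1)) - f (y (t - 1))\<bar> < e1"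
        using cf unfolding continuous_at_eps_delta dist_real_def by blast
      show ?thesis
      proof (intro exI[of _ d] conjI allI impI d(1))
        fix r assume r: "t < r \<and> r < t + d"
        have Rt: "R t = 0" using yt by (simp add: R_def)
        show "- I t - R t - e * (r - t) \<le> - I r - R r"
        proof (cases "f (y (t - 1)) = 0")
          case True
          have small: "\<bar>f (y (x - 1))\<bar> \<le> e1" if "t \<le> x" "x \<le> r" for x
            using d(2)[of x] that r True by auto
          have "I r - I t \<le> K * e1 * (r - t)"
            using delayed_product_small[of t r e1] small I_diff[of t r] r t e1 by auto
          moreover have "R r \<le> K * e1 * (r - t)"
          proof -
            have "y (t - 1) = 0" using True a by (simp add: f_def)
            then have "\<bar>y (r - 1)\<bar> \<le> K * (r - t)" using y_lipschitz[of "t - 1" "r - 1"] t r by simp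
            then have "\<bar>y (r - 1) * f (y (r - 1))\<bar> \<le> K * (r - t) * e1"
              unfolding abs_mult using small[of r] r K_nonneg by (intro mult_mono) auto
            then show ?thesis using F_le[of "y (r - 1)"] R_nonneg(2)[of r] by (simp add: mult_ac)
          qed
          moreover have "2 * (K * e1) \<le> e" using True K_nonneg e by (simp add: e1_def field_simps)
          then have "2 * (K * e1) * (r - t) \<le> e * (r - t)" using r by (intro mult_right_mono) auto
          ultimately show ?thesis using Rt by (simp add: algebra_simps)
        next
          case False
          have "f (y (x - 1)) > 0" if "t \<le> x" "x \<le> r" for x
            using d(2)[of x] that r False by (auto simp: e1_def)
          then have stick: "y x = - L" if "t \<le> x" "x \<le> r" for x
            using path.z_sticks[of t x] path_eq[of t] path_eq[of x] yt t that by (simp add: less_imp_le)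
          then have "integral {t..r} (\<lambda>x. s x * s (x - 1)) = integral {t..r} (\<lambda>x. 0)"
            by (intro Henstock_Kurzweil_Integration.integral_cong) (simp add: s_def)
          then have "I r = I t" using I_diff[of t r] t r by simp
          moreover have "R r = 0" using stick[of r] r by (simp add: R_def)
          ultimately show ?thesis using Rt e r by simp
        qed
      qed
    qed
  next
    fix t e :: real assume t: "1 < t" "t \<le> T" and e: "e > 0"
    show "\<exists>d>0. \<forall>r. 1 \<le> r \<and> t - d < r \<and> r < t \<longrightarrow> - I r - R r \<le> - I t - R t + e"
    proof (cases "y t > - L")
      case True
      then obtain d where d: "d > 0" "\<And>r. 1 \<le> r \<Longrightarrow> \<bar>r - t\<bar> < d \<Longrightarrow> - I r - R r = - I t - R t"
        using local_const[of t] t by auto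
      show ?thesis
      proof (intro exI[of _ d] conjI allI impI d(1))
        fix r assume r: "1 \<le> r \<and> t - d < r \<and> r < t"
        then show "- I r - R r \<le> - I t - R t + e" using d(2)[of r] e by simp
      qed
    next
      case False
      define d where "d = e / (K * K + 1)"
      have d: "d > 0" using e by (simp add: d_def add_nonneg_pos)
      show ?thesis
      proof (intro exI[of _ d] conjI allI impI d)
        fix r assume r: "1 \<le> r \<and> t - d < r \<and> r < t"
        have "I t - I r \<le> K * K * (t - r)"
          using delayed_product_small[of r t K] f_bound[OF y_ge] K_nonneg I_diff[of r t] r by auto
        also have "\<dots> \<le> (K * K + 1) * d"
          using r by (intro mult_mono) auto
        also have "\<dots> = e" by (simp add: d_def add_nonneg_pos less_imp_neq[symmetric])
        finally show "- I r - R r \<le> - I t - R t + e"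
          using False R_nonneg(1)[of r] by (simp add: R_def)
      qed
    qed
  qed
  moreover have "I 1 = 0" by (simp add: I_def)
  ultimately show ?thesis using R_nonneg(1)[of T] R_nonneg(2)[of 1] by (simp add: I_def)
qed

end

section \<open>Energy estimate, boundedness and convergence\<close>

context delayed_reflection begin

lemma y_lipschitz_abs: "0 \<le> p \<Longrightarrow> 0 \<le> q \<Longrightarrow> \<bar>y p - y q\<bar> \<le> K * \<bar>p - q\<bar>"
  using y_lipschitz[of p q] y_lipschitz[of q p] by (cases "p \<le> q") (auto simp: abs_minus_commute)

lemma s_squared_integrable: "(\<lambda>x. (s x)\<^sup>2) integrable_on {r..t}"
proof (rule bounded_borel_integral)
  show "\<bar>(s x)\<^sup>2\<bar> \<le> K\<^sup>2" for x
    using power_mono[OF s_bound[of x] abs_ge_zero, of 2] by simp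
qed measurable

text \<open>Reflection replaces \<open>- f (y (t - 1))\<close> by \<open>0\<close>, and \<open>0\<close> satisfies every sector condition.\<close>

lemma slope_sector: "t \<ge> 0 \<Longrightarrow> (s t)\<^sup>2 \<le> k * - (s t * y (t - 1))"
  using sector[OF y_ge, of "t - 1"] by (simp add: s_def mult.commute)

text \<open>The derivative \<open>s\<close>, cut off outside \<open>(0, T)\<close>, is inserted into the Popov inequality. Its integral
over the window \<open>[t - 1, t]\<close> is \<open>y t - y (t - 1)\<close>: the part with \<open>y t\<close> integrates to squares of
end values, the part with \<open>y (t - 1)\<close> is bounded from below by the sector condition, and the
product of \<open>s\<close> with its own delay by the Popov integral.\<close>

proposition energy_estimate:
  assumes T: "1 \<le> T"
  shows "(1 / k - 2 / pi) * integral {1..T} (\<lambda>x. (s x)\<^sup>2) + (y T)\<^sup>2 / 2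
    \<le> (y 1)\<^sup>2 / 2 + 2 / pi * integral {0..1} (\<lambda>x. (s x)\<^sup>2) + 4 / pi\<^sup>2 * F (y 0)"
proof -
  define w where "w t = (if 0 < t \<and> t < T then s t else 0)" for t
  define Y where "Y t = y (max 0 (min T t))" for t
  define N where "N = path.corners \<union> {0, T}"
  have N: "countable N" using path.countable_corners by (simp add: N_def)
  have w_meas [measurable]: "w \<in> borel_measurable borel" unfolding w_def by measurable
  have w_bound: "\<bar>w t\<bar> \<le> K" for t using s_bound K_nonneg by (simp add: w_def)
  have Y_meas [measurable]: "Y \<in> borel_measurable borel" unfolding Y_def by measurable
  have Y_lip: "\<bar>Y p - Y q\<bar> \<le> K * \<bar>p - q\<bar>" for p q
  proof -
    have "\<bar>Y p - Y q\<bar> \<le> K * \<bar>max 0 (min T p) - max 0 (min T q)\<bar>"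
      unfolding Y_def by (rule y_lipschitz_abs) auto
    also have "\<dots> \<le> K * \<bar>p - q\<bar>" using K_nonneg T by (intro mult_left_mono) auto
    finally show ?thesis .
  qed
  have local: "isCont w t \<and> (Y has_real_derivative w t) (at t)" if t: "t \<notin> N" for t
  proof -
    have "t \<noteq> 0" "t \<noteq> T" using t by (auto simp: N_def)
    then consider "t < 0" | "0 < t" "t < T" | "T < t" by linarith
    then show ?thesis
    proof cases
      case 1
      have "\<forall>\<^sub>F x in nhds t. x \<in> {..<0}" using 1 by (intro eventually_nhds_in_open) auto
      then have "\<forall>\<^sub>F x in nhds t. w x = 0" "\<forall>\<^sub>F x in nhds t. Y x = y 0"
        by (auto elim!: eventually_mono simp: w_def Y_def T)
      then show ?thesis
        using isCont_cong[of w "\<lambda>_. 0" t] DERIV_cong_ev[of t t Y "\<lambda>_. y 0" "w t" 0] 1 by (simp add: w_def)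
    next
      case 2
      have "\<forall>\<^sub>F x in nhds t. x \<in> {0<..<T}" using 2 by (intro eventually_nhds_in_open) auto
      then have "\<forall>\<^sub>F x in nhds t. w x = s x" "\<forall>\<^sub>F x in nhds t. Y x = y x"
        by (auto elim!: eventually_mono simp: w_def Y_def)
      then show ?thesis
        using isCont_cong[of w s t] DERIV_cong_ev[of t t Y y "w t" "s t"] 2 t s_isCont[of t] y_deriv[of t]
        by (simp add: w_def N_def)
    next
      case 3
      have "\<forall>\<^sub>F x in nhds t. x \<in> {T<..}" using 3 by (intro eventually_nhds_in_open) auto
      then have "\<forall>\<^sub>F x in nhds t. w x = 0" "\<forall>\<^sub>F x in nhds t. Y x = y T"
        using T by (auto elim!: eventually_mono simp: w_def Y_def)
      then show ?thesis
        using isCont_cong[of w "\<lambda>_. 0" t] DERIV_cong_ev[of t t Y "\<lambda>_. y T" "w t" 0] 3 by (simp add: w_def)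
    qed
  qed
  have window: "(\<integral>u. indicator {0..<1} u * w (t - u) \<partial>lborel) = Y t - Y (t - 1)" for t
  proof -
    have "((\<lambda>u. w (t - u)) has_integral (- Y (t - 1) - - Y (t - 0))) {0..1}"
    proof (rule has_integral_abs_continuous[where N = "(\<lambda>x. t - x) ` N"])
      show "abs_continuous_on {0..1} (\<lambda>u. - Y (t - u))"
      proof (rule abs_continuous_on_lipschitz)
        show "\<bar>- Y (t - v) - - Y (t - u)\<bar> \<le> K * (v - u)" if "u \<le> v" for u v
          using Y_lip[of "t - u" "t - v"] that by (simp add: algebra_simps)
      qed
      show "negligible ((\<lambda>x. t - x) ` N)" using N by (intro negligible_countable) simp
      show "((\<lambda>u. - Y (t - u)) has_real_derivative w (t - u)) (at u within {0..1})"
        if u: "u \<in> {0..1} - (\<lambda>x. t - x) ` N" for u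
      proof -
        have "t - u \<notin> N" using u by (metis DiffD2 add_diff_cancel_left' diff_diff_eq2 imageI)
        then have "(Y has_real_derivative w (t - u)) (at (t - u))" using local by blast
        then have "((\<lambda>u. Y (t - u)) has_real_derivative w (t - u) * (- 1)) (at u)"
          by (rule DERIV_chain2[where g = "\<lambda>u. t - u"]) (auto intro!: derivative_eq_intros)
        from DERIV_minus[OF this] show ?thesis by (auto intro: DERIV_subset)
      qed
    qed simp
    then have "integral {0..1} (\<lambda>u. w (t - u)) = Y t - Y (t - 1)" by (simp add: integral_unique)
    moreover have "(\<integral>u. indicator {0..1} u * w (t - u) \<partial>lborel) = integral {0..1} (\<lambda>u. w (t - u))"
      by (rule bounded_borel_integral(2)[OF _ w_bound]) measurable
    moreover have "(\<integral>u. indicator {0..<1} u * w (t - u) \<partial>lborel) = (\<integral>u. indicator {0..1} u * w (t - u) \<partial>lborel)"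
    proof (rule integral_cong_AE)
      show "AE u in lborel. indicator {0..<1} u * w (t - u) = indicator {0..1} u * w (t - u)"
        using AE_lborel_singleton[of "1::real"] by eventually_elim (auto simp: indicator_def)
    qed measurable
    ultimately show ?thesis by simp
  qed
  have conv: "(\<integral>t. w t * g t \<partial>lborel) = integral {0..T} (\<lambda>t. s t * g t)"
    if [measurable]: "g \<in> borel_measurable borel" and g: "\<And>t. \<bar>g t\<bar> \<le> K" for g
  proof -
    have "(\<integral>t. w t * g t \<partial>lborel) = (\<integral>t. indicator {0..T} t * (w t * g t) \<partial>lborel)"
      by (rule Bochner_Integration.integral_cong) (auto simp: w_def indicator_def)
    also have "\<dots> = integral {0..T} (\<lambda>t. w t * g t)"
    proof (rule bounded_borel_integral(2))
      show "\<bar>w t * g t\<bar> \<le> K * K" for t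
        unfolding abs_mult using w_bound g K_nonneg by (intro mult_mono) auto
    qed measurable
    also have "\<dots> = integral {0..T} (\<lambda>t. s t * g t)"
      by (rule integral_spike[of "{0, T}"]) (auto simp: w_def)
    finally show ?thesis .
  qed
  have sg: "(\<lambda>t. s t * g t) integrable_on {p..q}" if [measurable]: "g \<in> borel_measurable borel"
    and g: "\<And>t. \<bar>g t\<bar> \<le> K" for g p q
  proof (rule bounded_borel_integral(1))
    show "\<bar>s t * g t\<bar> \<le> K * K" for t
      unfolding abs_mult using s_bound g K_nonneg by (intro mult_mono) auto
  qed measurable
  have split: "integral {0..T} g = integral {0..1} g + integral {1..T} g" if "g integrable_on {0..T}" for g :: "real \<Rightarrow> real"
    using Henstock_Kurzweil_Integration.integral_combine[of 0 1 T g] that T by simp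
  \<comment> \<open>\<open>G t\<close> is the integral of \<open>w\<close> over \<open>[t - 1, t]\<close>.\<close>
  define G where "G t = Y t - Y (t - 1)" for t
  have G_meas: "G \<in> borel_measurable borel" unfolding G_def by measurable
  have G_bound: "\<bar>G t\<bar> \<le> K" for t using Y_lip[of t "t - 1"] by (simp add: G_def)
  have G_early: "G t = y t - y 0" if "0 \<le> t" "t \<le> 1" for t
  proof -
    have "max 0 (min T t) = t" "max 0 (min T (t - 1)) = 0" using that T by auto
    then show ?thesis by (simp add: G_def Y_def)
  qed
  have G_late: "G t = y t - y (t - 1)" if "1 \<le> t" "t \<le> T" for t
  proof -
    have "max 0 (min T t) = t" "max 0 (min T (t - 1)) = t - 1" using that by auto
    then show ?thesis by (simp add: G_def Y_def)
  qed
  define S0 S J where "S0 = integral {0..1} (\<lambda>x. (s x)\<^sup>2)" and "S = integral {1..T} (\<lambda>x. (s x)\<^sup>2)"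
    and "J = integral {1..T} (\<lambda>t. s t * y (t - 1))"
  have "(\<integral>t. w t * G t \<partial>lborel)
    \<le> 2 / pi * (\<integral>t. (w t)\<^sup>2 \<partial>lborel) + 4 / pi\<^sup>2 * (\<integral>t. w t * w (t - 1) \<partial>lborel)"
    unfolding G_def window[symmetric]
  proof (rule delay_form_le[OF w_meas w_bound _ _ N])
    show "w t = 0" if "t \<ge> real (nat \<lceil>T\<rceil>)" for t
    proof -
      have "T \<le> t" using that T of_nat_ceiling[of T] by linarith
      then show ?thesis by (simp add: w_def)
    qed
    show "w t = 0" if "t < 0" for t using that by (simp add: w_def)
    show "isCont w t" if "t \<notin> N" for t using local[OF that] by blast
  qed
  also have "(\<integral>t. (w t)\<^sup>2 \<partial>lborel) = S0 + S"
  proof -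
    have "(\<integral>t. (w t)\<^sup>2 \<partial>lborel) = integral {0..T} (\<lambda>t. s t * w t)"
      using conv[OF w_meas w_bound] by (simp add: power2_eq_square)
    also have "\<dots> = integral {0..T} (\<lambda>x. (s x)\<^sup>2)"
      by (rule integral_spike[of "{0, T}"]) (auto simp: w_def power2_eq_square)
    finally show ?thesis using split[OF s_squared_integrable] by (simp add: S0_def S_def)
  qed
  also have "(\<integral>t. w t * w (t - 1) \<partial>lborel) = integral {1..T} (\<lambda>x. s x * s (x - 1))"
  proof -
    have m: "(\<lambda>t. w (t - 1)) \<in> borel_measurable borel" by measurable
    have "(\<integral>t. w t * w (t - 1) \<partial>lborel) = integral {0..1} (\<lambda>t. s t * w (t - 1)) + integral {1..T} (\<lambda>t. s t * w (t - 1))"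
      using conv[OF m w_bound] split[OF sg[OF m w_bound]] by simp
    also have "integral {0..1} (\<lambda>t. s t * w (t - 1)) = integral {0..1::real} (\<lambda>t. 0)"
      by (rule Henstock_Kurzweil_Integration.integral_cong) (auto simp: w_def)
    also have "integral {1..T} (\<lambda>t. s t * w (t - 1)) = integral {1..T} (\<lambda>x. s x * s (x - 1))"
      by (rule integral_spike[of "{1}"]) (auto simp: w_def)
    finally show ?thesis by simp
  qed
  also have "(\<integral>t. w t * G t \<partial>lborel) = (y 1 - y 0)\<^sup>2 / 2 + ((y T)\<^sup>2 - (y 1)\<^sup>2) / 2 - J"
  proof -
    have "(\<integral>t. w t * G t \<partial>lborel) = integral {0..1} (\<lambda>t. s t * G t) + integral {1..T} (\<lambda>t. s t * G t)"
      using conv[OF G_meas G_bound] split[OF sg[OF G_meas G_bound]] by simp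
    also have "integral {0..1} (\<lambda>t. s t * G t) = (y 1 - y 0)\<^sup>2 / 2"
    proof -
      have "((\<lambda>t. s t * y t - s t * y 0) has_integral ((y 1)\<^sup>2 - (y 0)\<^sup>2) / 2 - (y 1 - y 0) * y 0) {0..1}"
        by (intro has_integral_diff y_squared_integral has_integral_mult_left y_integral) auto
      then have "((\<lambda>t. s t * G t) has_integral ((y 1)\<^sup>2 - (y 0)\<^sup>2) / 2 - (y 1 - y 0) * y 0) {0..1}"
        by (rule has_integral_eq[rotated]) (simp add: G_early algebra_simps)
      moreover have "((y 1)\<^sup>2 - (y 0)\<^sup>2) / 2 - (y 1 - y 0) * y 0 = (y 1 - y 0)\<^sup>2 / 2"
        by (simp add: power2_eq_square field_simps)
      ultimately show ?thesis by (simp add: integral_unique)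
    qed
    also have "integral {1..T} (\<lambda>t. s t * G t) = ((y T)\<^sup>2 - (y 1)\<^sup>2) / 2 - J"
    proof -
      have A: "((\<lambda>t. s t * y t) has_integral ((y T)\<^sup>2 - (y 1)\<^sup>2) / 2) {1..T}"
        using T by (intro y_squared_integral) auto
      have "((\<lambda>t. s t * y t - s t * G t) has_integral ((y T)\<^sup>2 - (y 1)\<^sup>2) / 2 - integral {1..T} (\<lambda>t. s t * G t)) {1..T}"
        by (rule has_integral_diff[OF A integrable_integral[OF sg[OF G_meas G_bound]]])
      then have "((\<lambda>t. s t * y (t - 1)) has_integral ((y T)\<^sup>2 - (y 1)\<^sup>2) / 2 - integral {1..T} (\<lambda>t. s t * G t)) {1..T}"
        by (rule has_integral_eq[rotated]) (simp add: G_late algebra_simps)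
      then show ?thesis by (simp add: J_def integral_unique)
    qed
    finally show ?thesis by simp
  qed
  finally have main: "(y 1 - y 0)\<^sup>2 / 2 + ((y T)\<^sup>2 - (y 1)\<^sup>2) / 2 - J
    \<le> 2 / pi * (S0 + S) + 4 / pi\<^sup>2 * integral {1..T} (\<lambda>x. s x * s (x - 1))" .
  have "S \<le> k * - J"
  proof -
    have A: "(\<lambda>t. s t * y t) integrable_on {1..T}"
      using y_squared_integral[of 1 T] T by (auto simp: integrable_on_def)
    have B: "(\<lambda>t. s t * y t - s t * G t) integrable_on {1..T}"
      by (rule integrable_diff[OF A sg[OF G_meas G_bound]])
    have "(\<lambda>t. s t * y (t - 1)) integrable_on {1..T}"
      by (rule integrable_eq[OF B]) (simp add: G_late algebra_simps)
    then have J: "((\<lambda>t. k * - (s t * y (t - 1))) has_integral k * - J) {1..T}"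
      unfolding J_def by (intro has_integral_mult_right has_integral_neg integrable_integral)
    show ?thesis unfolding S_def
      by (rule has_integral_le[OF integrable_integral[OF s_squared_integrable] J]) (use slope_sector in auto)
  qed
  then have "1 / k * S \<le> - J" using k_pos by (simp add: field_simps)
  moreover have "4 / pi\<^sup>2 * integral {1..T} (\<lambda>x. s x * s (x - 1)) \<le> 4 / pi\<^sup>2 * F (y 0)"
    by (intro mult_left_mono popov_integral[OF T]) auto
  moreover have "(y 1 - y 0)\<^sup>2 \<ge> 0" by simp
  moreover have "(1 / k - 2 / pi) * S = 1 / k * S - 2 / pi * S" "2 / pi * (S0 + S) = 2 / pi * S0 + 2 / pi * S"
    by (simp_all only: left_diff_distrib distrib_left)
  ultimately show ?thesis using main unfolding S_def[symmetric] S0_def[symmetric] diff_divide_distrib by linarith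
qed

lemma S_nonneg: "integral {r..t} (\<lambda>x. (s x)\<^sup>2) \<ge> 0"
  by (rule integral_nonneg[OF s_squared_integrable]) simp

lemma k_gap: "k < pi / 2 \<Longrightarrow> 1 / k - 2 / pi > 0"
  using k_pos by (simp add: field_simps)

text \<open>The energy estimate bounds \<open>y\<close> after time \<open>1\<close> by its behaviour on \<open>[0, 1]\<close>, where the forcing is
given by the initial values.\<close>

proposition y_bound:
  assumes k: "k < pi / 2" and init: "\<And>\<theta>. - 1 \<le> \<theta> \<Longrightarrow> \<theta> \<le> 0 \<Longrightarrow> \<bar>y \<theta>\<bar> \<le> \<eta>" and t: "t \<ge> - 1"
  shows "\<bar>y t\<bar> \<le> 2 * (\<eta> + a * (exp \<eta> - 1))"
proof -
  define m where "m = a * (exp \<eta> - 1)"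
  have \<eta>: "\<eta> \<ge> 0" using init[of 0] by simp
  then have m: "m \<ge> 0" using a by (simp add: m_def)
  have f_init: "\<bar>f (y (r - 1))\<bar> \<le> m" if "0 \<le> r" "r \<le> 1" for r
    unfolding m_def using that by (intro f_abs_le init) auto
  have early: "\<bar>y r\<bar> \<le> \<eta> + m" if "0 \<le> r" "r \<le> 1" for r
  proof -
    have "\<bar>y r - y 0\<bar> \<le> m * (r - 0)"
      using path.z_lipschitz[of 0 r m] path_eq f_init that by simp
    also have "\<dots> \<le> m" using that m by (simp add: mult_left_le)
    finally show ?thesis using init[of 0] by simp
  qed
  consider "t \<le> 0" | "0 \<le> t" "t \<le> 1" | "1 \<le> t" by linarith
  then show ?thesis
  proof cases
    case 1 then show ?thesis using init[of t] t \<eta> m by (simp add: m_def[symmetric])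
  next
    case 2 then show ?thesis using early[of t] \<eta> m by (simp add: m_def[symmetric])
  next
    case 3
    have S0: "integral {0..1} (\<lambda>x. (s x)\<^sup>2) \<le> m\<^sup>2"
    proof -
      have "((\<lambda>x. m\<^sup>2) has_integral m\<^sup>2) {0..1::real}"
        using has_integral_const_real[of "m\<^sup>2" 0 "1::real"] by simp
      moreover have "(s x)\<^sup>2 \<le> m\<^sup>2" if "x \<in> {0..1}" for x
        using power_mono[OF f_init[of x] abs_ge_zero, of 2] that m by (simp add: s_def)
      ultimately show ?thesis
        using has_integral_le[OF integrable_integral[OF s_squared_integrable]] by blast
    qed
    have "F (y 0) \<le> \<bar>y 0\<bar> * \<bar>f (y 0)\<bar>" using F_le[of "y 0"] by (simp add: abs_mult[symmetric])
    also have "\<dots> \<le> \<eta> * m" using init[of 0] f_init[of 1] \<eta> by (intro mult_mono) auto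
    finally have F: "F (y 0) \<le> \<eta> * m" .
    have "(y 1)\<^sup>2 \<le> (\<eta> + m)\<^sup>2" using power_mono[OF early[of 1] abs_ge_zero, of 2] by simp
    moreover have "2 / pi * integral {0..1} (\<lambda>x. (s x)\<^sup>2) \<le> 1 * m\<^sup>2"
      using S0 S_nonneg pi_bounds by (intro mult_mono) auto
    moreover have "4 / pi\<^sup>2 * F (y 0) \<le> 1 * (\<eta> * m)"
    proof (intro mult_mono F F_nonneg)
      show "4 / pi\<^sup>2 \<le> 1" using mult_mono[of 3 pi 3 pi] pi_bounds by (simp add: power2_eq_square)
    qed auto
    moreover have "0 \<le> (1 / k - 2 / pi) * integral {1..t} (\<lambda>x. (s x)\<^sup>2)"
      using k_gap[OF k] S_nonneg by (intro mult_nonneg_nonneg) auto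
    ultimately have "(y t)\<^sup>2 \<le> (\<eta> + m)\<^sup>2 + 2 * m\<^sup>2 + 2 * (\<eta> * m)"
      using energy_estimate[OF 3] by linarith
    also have "\<dots> \<le> (2 * (\<eta> + m))\<^sup>2"
      using \<eta> m by (simp add: power2_eq_square algebra_simps)
    finally have "\<bar>y t\<bar> \<le> 2 * (\<eta> + m)" using \<eta> m by (simp add: power2_le_iff_abs_le)
    then show ?thesis by (simp add: m_def)
  qed
qed

text \<open>The squared derivative has a finite integral, so over windows of length \<open>2\<close> the solution is
eventually almost constant. If it stayed away from \<open>0\<close> over such a window, the forcing
would have a fixed sign and size over its second half and would move the solution noticeably.\<close>

proposition y_tendsto_0:
  assumes k: "k < pi / 2"
  shows "(y \<longlongrightarrow> 0) at_top"
proof -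
  define S where "S t = integral {1..t} (\<lambda>x. (s x)\<^sup>2)" for t
  have S_diff: "S t - S r = integral {r..t} (\<lambda>x. (s x)\<^sup>2)" if "1 \<le> r" "r \<le> t" for r t
    using Henstock_Kurzweil_Integration.integral_combine[of 1 r t "\<lambda>x. (s x)\<^sup>2"] that s_squared_integrable
    by (simp add: S_def)
  define B where "B = ((y 1)\<^sup>2 / 2 + 2 / pi * integral {0..1} (\<lambda>x. (s x)\<^sup>2) + 4 / pi\<^sup>2 * F (y 0)) / (1 / k - 2 / pi)"
  have S_le: "S t \<le> B" if "1 \<le> t" for t
  proof -
    have "(y t)\<^sup>2 / 2 \<ge> 0" by simp
    then have "(1 / k - 2 / pi) * S t \<le> (y 1)\<^sup>2 / 2 + 2 / pi * integral {0..1} (\<lambda>x. (s x)\<^sup>2) + 4 / pi\<^sup>2 * F (y 0)"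
      using energy_estimate[OF that] unfolding S_def by linarith
    then show ?thesis using k_gap[OF k] by (simp add: B_def pos_le_divide_eq mult.commute)
  qed
  have slow: "\<exists>T\<ge>1. \<forall>r t. T \<le> r \<and> r \<le> t \<and> t \<le> r + 2 \<longrightarrow> \<bar>y t - y r\<bar> \<le> \<mu>" if \<mu>: "\<mu> > 0" for \<mu>
  proof -
    have bdd: "bdd_above (S ` {1..})" using S_le by (intro bdd_aboveI2) auto
    have "Sup (S ` {1..}) - \<mu>\<^sup>2 / 2 < Sup (S ` {1..})" using \<mu> by simp
    then obtain T where T: "1 \<le> T" "Sup (S ` {1..}) - \<mu>\<^sup>2 / 2 < S T"
      using less_cSup_iff[OF _ bdd] by auto
    have "\<bar>y t - y r\<bar> \<le> \<mu>" if rt: "T \<le> r" "r \<le> t" "t \<le> r + 2" for r t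
    proof -
      have "S t \<le> Sup (S ` {1..})" using rt T by (intro cSup_upper bdd) auto
      moreover have "S T \<le> S r" using S_diff[of T r] S_nonneg[of T r] rt T by simp
      ultimately have Srt: "integral {r..t} (\<lambda>x. (s x)\<^sup>2) \<le> \<mu>\<^sup>2 / 2" using S_diff[of r t] rt T by simp
      have bnd: "((\<lambda>x. \<mu> / 4 + 1 / \<mu> * (s x)\<^sup>2) has_integral (t - r) * (\<mu> / 4) + 1 / \<mu> * integral {r..t} (\<lambda>x. (s x)\<^sup>2)) {r..t}"
        using has_integral_const_real[of "\<mu> / 4" r t] rt
        by (intro has_integral_add has_integral_mult_right integrable_integral s_squared_integrable) auto
      have pt: "\<bar>s x\<bar> \<le> \<mu> / 4 + 1 / \<mu> * (s x)\<^sup>2" for x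
      proof -
        have "0 \<le> (\<mu> / 2 - \<bar>s x\<bar>)\<^sup>2 / \<mu>" using \<mu> by simp
        \<comment> \<open>Young's inequality; it replaces the Cauchy-Schwarz inequality for the integral of \<open>\<bar>s\<bar>\<close>.\<close>
        also have "\<dots> = \<mu> / 4 + 1 / \<mu> * (s x)\<^sup>2 - \<bar>s x\<bar>"
          using \<mu> by (simp add: power2_diff) (simp add: field_simps power2_eq_square)
        finally show ?thesis by simp
      qed
      have int: "(s has_integral y t - y r) {r..t}" using rt T by (intro y_integral) auto
      have "y t - y r \<le> (t - r) * (\<mu> / 4) + 1 / \<mu> * integral {r..t} (\<lambda>x. (s x)\<^sup>2)"
        by (rule has_integral_le[OF int bnd]) (use pt in \<open>auto simp: abs_le_iff\<close>)
      moreover have "- (y t - y r) \<le> (t - r) * (\<mu> / 4) + 1 / \<mu> * integral {r..t} (\<lambda>x. (s x)\<^sup>2)"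
        by (rule has_integral_le[OF has_integral_neg[OF int] bnd]) (use pt in \<open>auto simp: abs_le_iff\<close>)
      moreover have "(t - r) * (\<mu> / 4) \<le> \<mu> / 2"
        using mult_right_mono[of "t - r" 2 "\<mu> / 4"] rt \<mu> by simp
      moreover have "1 / \<mu> * integral {r..t} (\<lambda>x. (s x)\<^sup>2) \<le> \<mu> / 2"
      proof -
        have "1 / \<mu> * integral {r..t} (\<lambda>x. (s x)\<^sup>2) \<le> 1 / \<mu> * (\<mu>\<^sup>2 / 2)"
          using \<mu> Srt by (intro mult_left_mono) auto
        also have "\<dots> = \<mu> / 2" using \<mu> by (simp add: power2_eq_square)
        finally show ?thesis .
      qed
      ultimately have "y t - y r \<le> \<mu> \<and> - (y t - y r) \<le> \<mu>" by linarith
      then show ?thesis by (simp only: abs_le_iff)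
    qed
    then show ?thesis using T(1) by blast
  qed
  have "\<exists>T. \<forall>t\<ge>T. \<bar>y t\<bar> < e" if e: "e > 0" for e
  proof -
    define m where "m = min (f (e / 2)) (- f (- e / 2))"
    have m: "m > 0" using f_pos[of "e / 2"] f_neg[of "- e / 2"] e by (simp add: m_def)
    define \<mu> where "\<mu> = min (e / 2) (m / 2)"
    have \<mu>: "\<mu> > 0" "\<mu> \<le> e / 2" "\<mu> < m" using e m by (auto simp: \<mu>_def)
    obtain T where T: "T \<ge> 1" and slowT: "\<And>r t. T \<le> r \<Longrightarrow> r \<le> t \<Longrightarrow> t \<le> r + 2 \<Longrightarrow> \<bar>y t - y r\<bar> \<le> \<mu>"
      using slow[OF \<mu>(1)] by blast
    have "\<bar>y t\<bar> < e" if t: "T \<le> t" for t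
    proof (rule ccontr)
      assume "\<not> \<bar>y t\<bar> < e"
      then consider "y t \<ge> e" | "y t \<le> - e" by linarith
      then show False
      proof cases
        case 1
        have big: "y r \<ge> e / 2" if "t \<le> r" "r \<le> t + 2" for r
          using slowT[of t r] t that 1 \<mu> by linarith
        have sm: "s r \<le> - m" if "r \<in> {t + 1..t + 2}" for r
        proof -
          have "f (e / 2) \<le> f (y (r - 1))" using big[of "r - 1"] that by (intro f_mono) auto
          moreover have "y r > - L" using big[of r] that e L by auto
          ultimately show ?thesis by (simp add: s_def m_def)
        qed
        have const: "((\<lambda>x. - m) has_integral - m) {t + 1..t + 2}"
          using has_integral_const_real[of "- m" "t + 1" "t + 2"] by simp
        have "y (t + 2) - y (t + 1) \<le> - m"
          using T t by (intro has_integral_le[OF y_integral const sm]) auto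
        then show False using slowT[of "t + 1" "t + 2"] t \<mu> by linarith
      next
        case 2
        have big: "y r \<le> - e / 2" if "t \<le> r" "r \<le> t + 2" for r
          using slowT[of t r] t that 2 \<mu> by linarith
        have sm: "m \<le> s r" if r: "r \<in> {t + 1..t + 2}" for r
        proof -
          have "f (y (r - 1)) \<le> f (- e / 2)" using big[of "r - 1"] r by (intro f_mono) auto
          then have fm: "m \<le> - f (y (r - 1))" by (simp add: m_def)
          have "y r \<noteq> - L"
          proof
            assume "y r = - L"
            then have "- f (y (r - 1)) \<le> 0" using path.u_nonpos_at_floor[of r] path_eq[of r] r t T by simp
            then show False using fm m by simp
          qed
          then have "y r > - L" using y_ge[of r] by simp
          then show ?thesis using fm by (simp add: s_def)
        qed
        have const: "((\<lambda>x. m) has_integral m) {t + 1..t + 2}"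
          using has_integral_const_real[of m "t + 1" "t + 2"] by simp
        have "m \<le> y (t + 2) - y (t + 1)"
          using T t by (intro has_integral_le[OF const y_integral sm]) auto
        then show False using slowT[of "t + 1" "t + 2"] t \<mu> by linarith
      qed
    qed
    then show ?thesis by blast
  qed
  then show ?thesis
    unfolding tendsto_iff eventually_at_top_linorder dist_real_def by simp
qed

end

section \<open>Existence and uniqueness of solutions\<close>

definition delay_force :: "real \<Rightarrow> (real \<Rightarrow> real) \<Rightarrow> real \<Rightarrow> real" where
  "delay_force a y t = a * (exp (- y (t - 1)) - 1)"

definition delay_primitive :: "real \<Rightarrow> (real \<Rightarrow> real) \<Rightarrow> real \<Rightarrow> real" where
  "delay_primitive a y t =
     (if t \<ge> 0 then integral {0..t} (delay_force a y) else - integral {t..0} (delay_force a y))"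

lemma delay_force_continuous: "continuous_on UNIV y \<Longrightarrow> continuous_on A (delay_force a y)"
proof -
  assume y: "continuous_on UNIV y"
  have "continuous_on A (\<lambda>t. y (t - 1))"
    by (rule continuous_on_compose2[OF y]) (auto intro!: continuous_intros)
  then show ?thesis unfolding delay_force_def by (intro continuous_intros)
qed

lemma delay_primitive_deriv:
  assumes y: "continuous_on UNIV y"
  shows "(delay_primitive a y has_real_derivative delay_force a y t) (at t)"
proof -
  define c where "c = \<bar>t\<bar> + 1"
  let ?g = "delay_force a y"
  have int: "?g integrable_on {p..q}" for p q
    by (intro integrable_continuous_real delay_force_continuous y)
  have eq: "delay_primitive a y x = integral {- c..x} ?g - integral {- c..0} ?g" if "x \<in> {- c<..<c}" for x
    using Henstock_Kurzweil_Integration.integral_combine[of "- c" 0 x ?g]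
      Henstock_Kurzweil_Integration.integral_combine[of "- c" x 0 ?g] int that
    by (auto simp: delay_primitive_def c_def)
  have t: "t \<in> {- c<..<c}" by (auto simp: c_def)
  have "((\<lambda>x. integral {- c..x} ?g) has_real_derivative ?g t) (at t within {- c..c})"
    using t by (intro integral_has_real_derivative delay_force_continuous y) auto
  then have "((\<lambda>x. integral {- c..x} ?g) has_real_derivative ?g t) (at t within {- c<..<c})"
    by (rule DERIV_subset) auto
  then have "((\<lambda>x. integral {- c..x} ?g) has_real_derivative ?g t) (at t)"
    using t by (simp add: at_within_open[of t "{- c<..<c}"])
  then have "((\<lambda>x. integral {- c..x} ?g - integral {- c..0} ?g) has_real_derivative ?g t) (at t)"
    using DERIV_diff[OF _ DERIV_const] by fastforce
  then show ?thesis
    by (rule has_field_derivative_transform_within_open[where S = "{- c<..<c}"]) (use t eq in auto)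
qed

lemma delay_primitive_cong:
  assumes "\<And>x. x \<le> c \<Longrightarrow> y x = y' x" "0 \<le> t" "t \<le> c + 1"
  shows "delay_primitive a y t = delay_primitive a y' t"
  using assms unfolding delay_primitive_def
  by (auto intro!: Henstock_Kurzweil_Integration.integral_cong simp: delay_force_def)

lemma reflected_cong:
  assumes "\<And>r. 0 \<le> r \<Longrightarrow> r \<le> t \<Longrightarrow> V r = V' r" "0 \<le> t"
  shows "reflected b m V t = reflected b m V' t"
proof -
  have "(\<lambda>s. - b - V s) ` {0..t} = (\<lambda>s. - b - V' s) ` {0..t}"
    using assms(1) by (intro image_cong) auto
  then show ?thesis using assms by (simp add: reflected_def running_max_def)
qed

lemma reflected_path_delay:
  assumes "continuous_on UNIV y" "m \<ge> - L"
  shows "reflected_path L m (delay_force a y) (delay_primitive a y)"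
  using assms by unfold_locales
    (auto intro: delay_force_continuous delay_primitive_deriv simp: delay_primitive_def)

text \<open>The method of steps: the forcing at time \<open>t\<close> only uses values up to \<open>t - 1\<close>, so iterating the map
\<open>\<Psi>\<close> settles one more unit of time in each step, and no fixed-point theorem is needed.\<close>

proposition delayed_reflection_exists:
  fixes \<phi> :: "real \<Rightarrow> real"
  assumes a: "a > 0" and L: "L > 0" and \<phi>: "continuous_on {-1..0} \<phi>"
    and \<phi>_ge: "\<And>\<theta>. \<theta> \<in> {-1..0} \<Longrightarrow> \<phi> \<theta> \<ge> - L"
  obtains y U where "delayed_reflection a L y U" "\<And>\<theta>. \<theta> \<in> {-1..0} \<Longrightarrow> y \<theta> = \<phi> \<theta>"
proof -
  define x where "x t = \<phi> (max (- 1) (min t 0))" for t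
  have x_cont: "continuous_on A x" for A
    unfolding x_def by (intro continuous_on_compose2[OF \<phi>] continuous_intros) auto
  have x_ge: "x t \<ge> - L" for t
    unfolding x_def by (intro \<phi>_ge) auto
  define \<Psi> where "\<Psi> y t = (if t \<le> 0 then x t else reflected L (x 0) (delay_primitive a y) t)" for y t
  define Y where "Y n = (\<Psi> ^^ n) x" for n
  have Y_Suc: "Y (Suc n) = \<Psi> (Y n)" for n by (simp add: Y_def)
  have \<Psi>_cont: "continuous_on UNIV (\<Psi> y)" if y: "continuous_on UNIV y" for y
  proof -
    interpret reflected_path L "x 0" "delay_force a y" "delay_primitive a y"
      by (rule reflected_path_delay[OF y x_ge])
    have "continuous_on ({..0} \<union> {0..}) (\<lambda>t. if t \<le> 0 then x t else reflected L (x 0) (delay_primitive a y) t)"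
      by (rule continuous_on_cases) (use x_cont cont_z z_0 in \<open>auto dest: antisym\<close>)
    moreover have "{..0} \<union> {0..} = (UNIV :: real set)" by auto
    ultimately show ?thesis by (simp add: \<Psi>_def[abs_def])
  qed
  have Y_cont: "continuous_on UNIV (Y n)" for n
    by (induction n) (simp_all add: Y_Suc \<Psi>_cont, simp add: Y_def x_cont)
  have \<Psi>_cong: "\<Psi> y t = \<Psi> y' t" if "\<And>r. r \<le> c \<Longrightarrow> y r = y' r" "t \<le> c + 1" for y y' c t
  proof (cases "t \<le> 0")
    case False
    have "reflected L (x 0) (delay_primitive a y) t = reflected L (x 0) (delay_primitive a y') t"
      using False that by (intro reflected_cong delay_primitive_cong[of c]) auto
    then show ?thesis using False by (simp add: \<Psi>_def)
  qed (simp add: \<Psi>_def)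
  have Y_step: "Y (Suc n) t = Y n t" if "t \<le> real n" for n t
    using that
  proof (induction n arbitrary: t)
    case 0
    then show ?case unfolding Y_Suc by (simp add: \<Psi>_def) (simp add: Y_def)
  next
    case (Suc n)
    have "\<Psi> (Y (Suc n)) t = \<Psi> (Y n) t"
      by (rule \<Psi>_cong[of "real n"]) (use Suc in auto)
    then show ?case by (simp only: Y_Suc)
  qed
  have Y_stable: "Y m t = Y n t" if "n \<le> m" "t \<le> real n" for m n t
    using that(1) by (induction rule: dec_induct) (use that(2) Y_step in auto)
  define y where "y t = Y (nat \<lceil>t\<rceil>) t" for t
  have y_eq: "y t = Y n t" if "t \<le> real n" for n t
  proof -
    have "nat \<lceil>t\<rceil> \<le> n" using that by (simp add: nat_le_iff ceiling_le_iff)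
    moreover have "t \<le> real (nat \<lceil>t\<rceil>)" by (rule of_nat_ceiling)
    ultimately show ?thesis unfolding y_def using Y_stable by metis
  qed
  have y_init: "y t = x t" if "t \<le> 0" for t
    using y_eq[of t 0] that by (simp add: Y_def)
  have y_cont: "continuous_on UNIV y"
  proof (subst continuous_on_eq_continuous_at, simp, clarify)
    fix t :: real
    obtain n :: nat where n: "t < real n" using reals_Archimedean2 by blast
    have "\<forall>\<^sub>F r in nhds t. r \<in> {..<real n}" using n by (intro eventually_nhds_in_open) auto
    then have "\<forall>\<^sub>F r in nhds t. y r = Y n r" by eventually_elim (simp add: y_eq)
    moreover have "isCont (Y n) t" using Y_cont[of n] by (simp add: continuous_on_eq_continuous_at)
    ultimately show "isCont y t" using isCont_cong by blast
  qed
  have y_refl: "y t = reflected L (y 0) (delay_primitive a y) t" if t: "0 \<le> t" for t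
  proof (cases "t = 0")
    case True
    interpret reflected_path L "y 0" "delay_force a y" "delay_primitive a y"
      by (rule reflected_path_delay[OF y_cont]) (use y_init[of 0] x_ge in simp)
    show ?thesis using z_0 True by simp
  next
    case False
    obtain n :: nat where n: "t \<le> real n" using real_arch_simple by blast
    have "y t = Y (Suc n) t" using n by (intro y_eq) simp
    also have "\<dots> = \<Psi> y t"
      unfolding Y_Suc by (rule \<Psi>_cong[of "real n"]) (use n y_eq in auto)
    finally show ?thesis using False t y_init[of 0] by (simp add: \<Psi>_def)
  qed
  have "delayed_reflection a L y (delay_primitive a y)"
  proof
    show "y t \<ge> - L" for t
    proof (cases "t \<le> 0")
      case True then show ?thesis using y_init x_ge by simp
    next
      case False
      interpret reflected_path L "y 0" "delay_force a y" "delay_primitive a y"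
        by (rule reflected_path_delay[OF y_cont]) (use y_init[of 0] x_ge in simp)
      show ?thesis using z_ge[of t] y_refl[of t] False by simp
    qed
    show "(delay_primitive a y has_real_derivative a * (exp (- y (t - 1)) - 1)) (at t)" for t
      using delay_primitive_deriv[OF y_cont, of a t] by (simp add: delay_force_def)
    show "y t = reflected L (y 0) (delay_primitive a y) t" if "t \<ge> 0" for t
      using y_refl that by blast
  qed (use a L y_cont in \<open>auto simp: delay_primitive_def\<close>)
  then show thesis
    by (rule that) (use y_init in \<open>auto simp: x_def\<close>)
qed

lemma z_rhs_antimono: "u' \<le> u \<Longrightarrow> z_rhs \<tau> \<alpha> p0 u v \<le> z_rhs \<tau> \<alpha> p0 u' v"
  by (auto simp: z_rhs_def)

text \<open>Once the delayed values agree, the right-hand side is nonincreasing in the current value, so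
the difference of two solutions cannot grow while it is positive. Here \<open>q\<close> is the last time
before \<open>t\<close> at which \<open>z1 \<le> z2\<close>.\<close>

lemma solution_le_step:
  assumes \<tau>: "\<tau> > 0" and z1: "is_solution \<tau> \<alpha> p0 x0 z1" and z2: "is_solution \<tau> \<alpha> p0 x0 z2"
    and c: "0 \<le> c" and agree: "\<And>r. - \<tau> \<le> r \<Longrightarrow> r \<le> c \<Longrightarrow> z1 r = z2 r"
    and t: "c \<le> t" "t \<le> c + \<tau>"
  shows "z1 t \<le> z2 t"
proof (rule ccontr)
  assume neg: "\<not> z1 t \<le> z2 t"
  define d where "d r = z1 r - z2 r" for r
  have d_cont: "continuous_on {c..t} d"
    unfolding d_def using z1 z2 c \<tau> unfolding is_solution_def
    by (intro continuous_intros) (auto elim: continuous_on_subset)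
  have "closed ({c..t} \<inter> d -` {..0})"
    by (rule continuous_closed_preimage[OF d_cont]) auto
  then have "compact ({c..t} \<inter> d -` {..0})"
    unfolding compact_eq_bounded_closed using bounded_subset[OF bounded_closed_interval, of _ c t] by auto
  moreover have "c \<in> {c..t} \<inter> d -` {..0}"
    using agree[of c] t c \<tau> by (simp add: d_def)
  ultimately obtain q where qm: "q \<in> {c..t} \<inter> d -` {..0}" "\<forall>r\<in>{c..t} \<inter> d -` {..0}. r \<le> q"
    using compact_attains_sup[of "{c..t} \<inter> d -` {..0}"] by blast
  then have q: "c \<le> q" "q \<le> t" "d q \<le> 0"
    and q_max: "\<And>r. c \<le> r \<Longrightarrow> r \<le> t \<Longrightarrow> d r \<le> 0 \<Longrightarrow> r \<le> q"
    by auto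
  obtain N1 N2 where N: "negligible N1" "negligible N2"
    and N1: "\<And>r. r \<notin> N1 \<Longrightarrow> r \<ge> 0 \<Longrightarrow> (z1 has_real_derivative z_rhs \<tau> \<alpha> p0 (z1 r) (z1 (r - \<tau>))) (at r)"
    and N2: "\<And>r. r \<notin> N2 \<Longrightarrow> r \<ge> 0 \<Longrightarrow> (z2 has_real_derivative z_rhs \<tau> \<alpha> p0 (z2 r) (z2 (r - \<tau>))) (at r)"
  proof -
    have *: "\<exists>N. negligible N \<and> (\<forall>r. r \<notin> N \<longrightarrow> r \<ge> 0 \<longrightarrow> (z has_real_derivative z_rhs \<tau> \<alpha> p0 (z r) (z (r - \<tau>))) (at r))"
      if "is_solution \<tau> \<alpha> p0 x0 z" for z
    proof -
      have "AE r in lebesgue. r \<ge> 0 \<longrightarrow> (z has_real_derivative z_rhs \<tau> \<alpha> p0 (z r) (z (r - \<tau>))) (at r)"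
        using that by (simp add: is_solution_def)
      then obtain N where "N \<in> null_sets lebesgue"
        "{r \<in> space lebesgue. \<not> (r \<ge> 0 \<longrightarrow> (z has_real_derivative z_rhs \<tau> \<alpha> p0 (z r) (z (r - \<tau>))) (at r))} \<subseteq> N"
        unfolding eventually_ae_filter by blast
      then show ?thesis by (intro exI[of _ N]) (auto simp: negligible_iff_null_sets)
    qed
    show thesis using *[OF z1] *[OF z2] that by blast
  qed
  define D where "D r = (if r = q then 0 else z_rhs \<tau> \<alpha> p0 (z1 r) (z1 (r - \<tau>)) - z_rhs \<tau> \<alpha> p0 (z2 r) (z2 (r - \<tau>)))" for r
  have "(D has_integral d t - d q) {q..t}"
  proof (rule has_integral_abs_continuous[where N = "insert q (N1 \<union> N2)"])
    show "abs_continuous_on {q..t} d"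
      unfolding d_def using z1 z2 q c unfolding is_solution_def
      by (intro abs_continuous_on_diff) (auto elim: abs_continuous_on_subset)
    show "negligible (insert q (N1 \<union> N2))" using N by simp
    show "(d has_real_derivative D r) (at r within {q..t})" if r: "r \<in> {q..t} - insert q (N1 \<union> N2)" for r
    proof -
      have "(d has_real_derivative z_rhs \<tau> \<alpha> p0 (z1 r) (z1 (r - \<tau>)) - z_rhs \<tau> \<alpha> p0 (z2 r) (z2 (r - \<tau>))) (at r)"
        unfolding d_def using r q c by (intro DERIV_diff N1 N2) auto
      then show ?thesis using r by (auto simp: D_def intro: DERIV_subset)
    qed
  qed (use q in auto)
  moreover have "((\<lambda>r. 0) has_integral 0) {q..t}" by simp
  ultimately have "d t - d q \<le> 0"
  proof (rule has_integral_le)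
    fix r assume r: "r \<in> {q..t}"
    show "D r \<le> 0"
    proof (cases "r = q")
      case False
      then have "d r > 0" using q_max[of r] r q by force
      then have "z2 r \<le> z1 r" by (simp add: d_def)
      moreover have "z1 (r - \<tau>) = z2 (r - \<tau>)" using r q t c by (intro agree) auto
      ultimately show ?thesis using z_rhs_antimono False by (simp add: D_def)
    qed (simp add: D_def)
  qed
  then show False using neg q by (simp add: d_def)
qed

lemma solution_unique:
  assumes \<tau>: "\<tau> > 0" and z1: "is_solution \<tau> \<alpha> p0 x0 z1" and z2: "is_solution \<tau> \<alpha> p0 x0 z2"
  shows "z1 = z2"
proof -
  have agree: "\<And>t. - \<tau> \<le> t \<Longrightarrow> t \<le> real n * \<tau> \<Longrightarrow> z1 t = z2 t" for n
  proof (induction n)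
    case 0
    then show ?case using z1 z2 by (auto simp: is_solution_def)
  next
    case (Suc n)
    show ?case
    proof (cases "t \<le> real n * \<tau>")
      case False
      have "t \<le> real n * \<tau> + \<tau>" using Suc.prems by (simp add: algebra_simps)
      moreover have "0 \<le> real n * \<tau>" using \<tau> by simp
      ultimately show ?thesis
        using solution_le_step[OF \<tau> z1 z2, of "real n * \<tau>" t] solution_le_step[OF \<tau> z2 z1, of "real n * \<tau>" t]
          Suc.IH False by force
    qed (use Suc in blast)
  qed
  show ?thesis
  proof (rule extensionalityI)
    show "z1 \<in> extensional {- \<tau>..}" "z2 \<in> extensional {- \<tau>..}"
      using z1 z2 by (auto simp: is_solution_def)
    show "z1 t = z2 t" if "t \<in> {- \<tau>..}" for t
    proof -
      obtain n :: nat where "t / \<tau> \<le> real n" using real_arch_simple by blast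
      then have "t \<le> real n * \<tau>" using \<tau> by (simp add: field_simps)
      then show ?thesis using agree that by simp
    qed
  qed
qed

lemma (in delayed_reflection) rescaled_solution:
  assumes \<tau>: "\<tau> > 0" and p0: "p0 = \<tau> / a * L"
    and init: "\<And>\<theta>. \<theta> \<in> {- \<tau>..0} \<Longrightarrow> x0 \<theta> = \<tau> / a * y (\<theta> / \<tau>)"
  shows "is_solution \<tau> a p0 x0 (\<lambda>t\<in>{- \<tau>..}. \<tau> / a * y (t / \<tau>))"
proof -
  define z where "z = (\<lambda>t\<in>{- \<tau>..}. \<tau> / a * y (t / \<tau>))"
  have z_eq: "z t = \<tau> / a * y (t / \<tau>)" if "t \<ge> - \<tau>" for t using that by (simp add: z_def)
  have "continuous_on {- \<tau>..} (\<lambda>t. \<tau> / a * y (t / \<tau>))"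
    using \<tau> by (intro continuous_intros continuous_on_compose2[OF cont_y]) auto
  then have "continuous_on {- \<tau>..} z"
    by (rule continuous_on_eq) (simp add: z_eq)
  moreover have "abs_continuous_on {0..} z"
  proof (rule abs_continuous_on_lipschitz)
    fix r t :: real assume rt: "r \<in> {0..}" "t \<in> {0..}" "r \<le> t"
    have "\<bar>y (t / \<tau>) - y (r / \<tau>)\<bar> \<le> K * (t / \<tau> - r / \<tau>)"
      using rt \<tau> by (intro y_lipschitz) (auto simp: divide_right_mono)
    then have "\<tau> / a * \<bar>y (t / \<tau>) - y (r / \<tau>)\<bar> \<le> \<tau> / a * (K * (t / \<tau> - r / \<tau>))"
      using \<tau> a by (intro mult_left_mono) auto
    also have "\<dots> = K / a * (t - r)" using \<tau> by (simp add: diff_divide_distrib[symmetric])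
    also have "\<tau> / a * \<bar>y (t / \<tau>) - y (r / \<tau>)\<bar> = \<bar>z t - z r\<bar>"
    proof -
      have "z t - z r = \<tau> / a * (y (t / \<tau>) - y (r / \<tau>))"
        using rt \<tau> z_eq[of t] z_eq[of r] by (simp add: right_diff_distrib)
      then show ?thesis using \<tau> a by (simp add: abs_mult)
    qed
    finally show "\<bar>z t - z r\<bar> \<le> K / a * (t - r)" .
  qed
  moreover have "AE t in lebesgue. t \<ge> 0 \<longrightarrow> (z has_real_derivative z_rhs \<tau> a p0 (z t) (z (t - \<tau>))) (at t)"
  proof -
    define N where "N = insert 0 ((\<lambda>t. \<tau> * t) ` path.corners)"
    have "negligible N"
      unfolding N_def using path.countable_corners by (intro negligible_countable) simp
    then have "AE t in lebesgue. t \<notin> N" by (intro AE_not_in) (simp add: negligible_iff_null_sets)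
    then show ?thesis
    proof eventually_elim
      fix t assume tN: "t \<notin> N"
      show "t \<ge> 0 \<longrightarrow> (z has_real_derivative z_rhs \<tau> a p0 (z t) (z (t - \<tau>))) (at t)"
      proof
        assume "t \<ge> 0"
        then have t: "t > 0" "t / \<tau> > 0" using tN \<tau> by (auto simp: N_def less_le)
        have "t / \<tau> \<notin> path.corners"
        proof
          assume "t / \<tau> \<in> path.corners"
          then have "\<tau> * (t / \<tau>) \<in> N" unfolding N_def by blast
          then show False using tN \<tau> by simp
        qed
        then have "(y has_real_derivative s (t / \<tau>)) (at (t / \<tau>))" using t y_deriv by blast
        then have "((\<lambda>t. y (t / \<tau>)) has_real_derivative s (t / \<tau>) * (1 / \<tau>)) (at t)"
          by (rule DERIV_chain2[where g = "\<lambda>t. t / \<tau>"]) (use \<tau> in \<open>auto intro!: derivative_eq_intros\<close>)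
        from DERIV_cmult[OF this, of "\<tau> / a"]
        have "((\<lambda>t. \<tau> / a * y (t / \<tau>)) has_real_derivative s (t / \<tau>) / a) (at t)"
          using \<tau> by simp
        then have "(z has_real_derivative s (t / \<tau>) / a) (at t)"
          by (rule has_field_derivative_transform_within_open[where S = "{0<..}"]) (use t \<tau> z_eq in auto)
        moreover have "s (t / \<tau>) / a = z_rhs \<tau> a p0 (z t) (z (t - \<tau>))"
        proof -
          have zt: "z t > - p0 \<longleftrightarrow> y (t / \<tau>) > - L"
          proof -
            have "z t > - p0 \<longleftrightarrow> \<tau> / a * - L < \<tau> / a * y (t / \<tau>)"
              using t \<tau> by (simp add: z_eq p0)
            also have "\<dots> \<longleftrightarrow> - L < y (t / \<tau>)"
              using \<tau> a by (intro mult_less_cancel_left_pos) auto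
            finally show ?thesis .
          qed
          have "(t - \<tau>) / \<tau> = t / \<tau> - 1" using \<tau> by (simp add: diff_divide_distrib)
          then have delayed: "exp (- (a / \<tau>) * z (t - \<tau>)) - 1 = - f (y (t / \<tau> - 1)) / a"
            using t \<tau> a by (simp add: z_eq f_def)
          show ?thesis
          proof (cases "y (t / \<tau>) > - L")
            case True
            then show ?thesis using zt delayed by (simp add: z_rhs_def s_def)
          next
            case False
            then have "y (t / \<tau>) = - L" using y_ge[of "t / \<tau>"] by simp
            then have "- f (y (t / \<tau> - 1)) \<le> 0"
              using path.u_nonpos_at_floor[of "t / \<tau>"] path_eq[of "t / \<tau>"] t by simp
            then have "- f (y (t / \<tau> - 1)) / a \<le> 0" using a by (intro divide_nonpos_pos) auto
            then show ?thesis using zt delayed False by (simp add: z_rhs_def s_def)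
          qed
        qed
        ultimately show "(z has_real_derivative z_rhs \<tau> a p0 (z t) (z (t - \<tau>))) (at t)" by simp
      qed
    qed
  qed
  ultimately show ?thesis
    unfolding is_solution_def z_def[symmetric] using init z_eq \<tau> by (auto simp: z_def)
qed

lemma solution_map_rescaled:
  assumes \<tau>: "\<tau> > 0" and a: "a > 0" and L: "L > 0" and p0: "p0 = \<tau> / a * L"
    and x0: "x0 \<in> initial_set \<tau> p0"
  obtains y U where "delayed_reflection a L y U"
    "\<And>\<theta>. \<theta> \<in> {- 1..0} \<Longrightarrow> y \<theta> = a / \<tau> * x0 (\<tau> * \<theta>)"
    "is_solution \<tau> a p0 x0 (solution_map \<tau> a p0 x0)"
    "\<And>t. t \<ge> - \<tau> \<Longrightarrow> solution_map \<tau> a p0 x0 t = \<tau> / a * y (t / \<tau>)"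
proof -
  have x0_cont: "continuous_on {- \<tau>..0} x0" and x0_ge: "\<And>\<theta>. \<theta> \<in> {- \<tau>..0} \<Longrightarrow> x0 \<theta> \<ge> - p0"
    using x0 by (auto simp: initial_set_def C_space_def)
  have maps: "\<tau> * \<theta> \<in> {- \<tau>..0}" if "\<theta> \<in> {- 1..0}" for \<theta>
    using that \<tau> mult_left_mono[of "- 1" \<theta> \<tau>] by (auto simp: mult_nonneg_nonpos)
  have "continuous_on {- 1..0} (\<lambda>\<theta>. a / \<tau> * x0 (\<tau> * \<theta>))"
    by (intro continuous_intros continuous_on_compose2[OF x0_cont]) (use maps in auto)
  moreover have "a / \<tau> * x0 (\<tau> * \<theta>) \<ge> - L" if "\<theta> \<in> {- 1..0}" for \<theta>
  proof -
    have "a / \<tau> * x0 (\<tau> * \<theta>) \<ge> a / \<tau> * - p0"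
      using x0_ge[OF maps[OF that]] a \<tau> by (intro mult_left_mono) auto
    then show ?thesis using a \<tau> by (simp add: p0)
  qed
  ultimately obtain y U where yU: "delayed_reflection a L y U"
    and y: "\<And>\<theta>. \<theta> \<in> {- 1..0} \<Longrightarrow> y \<theta> = a / \<tau> * x0 (\<tau> * \<theta>)"
    using delayed_reflection_exists[OF a L] by blast
  interpret delayed_reflection a L y U by (rule yU)
  have sol: "is_solution \<tau> a p0 x0 (\<lambda>t\<in>{- \<tau>..}. \<tau> / a * y (t / \<tau>))"
  proof (rule rescaled_solution[OF \<tau> p0])
    fix \<theta> assume "\<theta> \<in> {- \<tau>..0}"
    then have "\<theta> / \<tau> \<in> {- 1..0}" using \<tau> by (auto simp: field_simps)
    then show "x0 \<theta> = \<tau> / a * y (\<theta> / \<tau>)" using y a \<tau> by simp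
  qed
  have "solution_map \<tau> a p0 x0 = (\<lambda>t\<in>{- \<tau>..}. \<tau> / a * y (t / \<tau>))"
    unfolding solution_map_def
    by (rule the_equality[of "is_solution \<tau> a p0 x0", OF sol]) (rule solution_unique[OF \<tau> _ sol])
  note map_eq = this
  show thesis
  proof (rule that[OF yU y])
    show "is_solution \<tau> a p0 x0 (solution_map \<tau> a p0 x0)" using sol map_eq by simp
    show "solution_map \<tau> a p0 x0 t = \<tau> / a * y (t / \<tau>)" if "t \<ge> - \<tau>" for t
      using that map_eq by simp
  qed auto
qed

section \<open>Asymptotic stability\<close>

text \<open>With \<open>L = ln (x_max/c)\<close>, the hypothesis on \<open>\<alpha>\<close> says exactly that the sector slope
\<open>\<alpha> (exp L - 1) / L\<close> is below \<open>\<pi>/2\<close>.\<close>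

theorem mainTheorem1:
  fixes \<tau> x_max c \<alpha>_max \<alpha> p0 :: real
  assumes "\<tau> > 0"
    and "x_max > c" and "c > 0"
    and "\<alpha>_max = ln (x_max / c) / (x_max / c - 1)"
    and "\<alpha> \<in> {0<..<pi * \<alpha>_max / 2}"
    and "p0 = \<tau> / \<alpha> * ln (x_max / c)"
  shows "(\<forall>x0\<in>initial_set \<tau> p0. \<exists>!z. is_solution \<tau> \<alpha> p0 x0 z) \<and>
         asymptotically_stable_on \<tau> (initial_set \<tau> p0) (solution_map \<tau> \<alpha> p0)"
proof -
  define L where "L = ln (x_max / c)"
  have \<tau>: "\<tau> > 0" and \<alpha>: "\<alpha> > 0" and p0: "p0 = \<tau> / \<alpha> * L"
    using assms by (auto simp: L_def)
  have R: "x_max / c > 1" using assms by simp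
  then have L: "L > 0" by (simp add: L_def)
  have slope: "\<alpha> * ((exp L - 1) / L) < pi / 2"
  proof -
    define Q where "Q = x_max / c - 1"
    have Q: "Q > 0" "exp L - 1 = Q" using R by (auto simp: Q_def L_def)
    have "\<alpha> < pi * (L / Q) / 2" using assms by (simp add: L_def Q_def)
    then have "\<alpha> * (Q / L) < pi * (L / Q) / 2 * (Q / L)"
      using Q L by (intro mult_strict_right_mono divide_pos_pos) auto
    also have "\<dots> = pi / 2" using Q L by simp
    finally show ?thesis by (simp only: Q(2))
  qed
  let ?X = "initial_set \<tau> p0" and ?A = "solution_map \<tau> \<alpha> p0"
  \<comment> \<open>The bound of the normalized solution, carried back through \<open>z t = (\<tau>/\<alpha>) y (t/\<tau>)\<close>.\<close>
  define bd where "bd \<delta> = \<tau> / \<alpha> * (2 * (\<alpha> / \<tau> * \<delta> + \<alpha> * (exp (\<alpha> / \<tau> * \<delta>) - 1)))" for \<delta>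
  have bound: "\<bar>?A x0 t\<bar> \<le> bd \<delta>"
    if x0: "x0 \<in> ?X" and small: "\<And>\<theta>. \<theta> \<in> {- \<tau>..0} \<Longrightarrow> \<bar>x0 \<theta>\<bar> \<le> \<delta>" and t: "t \<ge> - \<tau>" for x0 \<delta> t
  proof -
    obtain y U where yU: "delayed_reflection \<alpha> L y U"
      and y: "\<And>\<theta>. \<theta> \<in> {- 1..0} \<Longrightarrow> y \<theta> = \<alpha> / \<tau> * x0 (\<tau> * \<theta>)"
      and A: "\<And>t. t \<ge> - \<tau> \<Longrightarrow> ?A x0 t = \<tau> / \<alpha> * y (t / \<tau>)"
      using solution_map_rescaled[OF \<tau> \<alpha> L p0 x0] by metis
    interpret delayed_reflection \<alpha> L y U by (rule yU)
    have "\<bar>y (t / \<tau>)\<bar> \<le> 2 * (\<alpha> / \<tau> * \<delta> + \<alpha> * (exp (\<alpha> / \<tau> * \<delta>) - 1))"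
    proof (rule y_bound)
      show "k < pi / 2" using slope by (simp add: k_def)
      show "- 1 \<le> t / \<tau>" using t \<tau> by (simp add: field_simps)
      fix \<theta> :: real assume \<theta>: "- 1 \<le> \<theta>" "\<theta> \<le> 0"
      have "\<tau> * \<theta> \<in> {- \<tau>..0}"
        using \<theta> \<tau> mult_left_mono[of "- 1" \<theta> \<tau>] by (auto simp: mult_nonneg_nonpos)
      then have "\<alpha> / \<tau> * \<bar>x0 (\<tau> * \<theta>)\<bar> \<le> \<alpha> / \<tau> * \<delta>"
        using \<alpha> \<tau> by (intro mult_left_mono small) auto
      then show "\<bar>y \<theta>\<bar> \<le> \<alpha> / \<tau> * \<delta>" using y[of \<theta>] \<theta> \<alpha> \<tau> by (simp add: abs_mult)
    qed
    then have "\<tau> / \<alpha> * \<bar>y (t / \<tau>)\<bar> \<le> bd \<delta>"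
      unfolding bd_def using \<tau> \<alpha> by (intro mult_left_mono) auto
    then show ?thesis using A[OF t] \<tau> \<alpha> by (simp add: abs_mult)
  qed
  have init_bdd: "bdd_above ((\<lambda>\<theta>. \<bar>x0 \<theta>\<bar>) ` {- \<tau>..0})" if "x0 \<in> ?X" for x0
  proof -
    have "continuous_on {- \<tau>..0} (\<lambda>\<theta>. \<bar>x0 \<theta>\<bar>)"
      using that by (intro continuous_intros) (auto simp: initial_set_def C_space_def)
    then have "compact ((\<lambda>\<theta>. \<bar>x0 \<theta>\<bar>) ` {- \<tau>..0})" by (rule compact_continuous_image) simp
    then show ?thesis by (intro bounded_imp_bdd_above compact_imp_bounded)
  qed
  have "bounded (?A x0 ` {- \<tau>..})" if x0: "x0 \<in> ?X" for x0
  proof -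
    have "\<bar>x0 \<theta>\<bar> \<le> sup_norm_on {- \<tau>..0} x0" if "\<theta> \<in> {- \<tau>..0}" for \<theta>
      unfolding sup_norm_on_def using that by (intro cSUP_upper init_bdd[OF x0])
    then have "\<bar>?A x0 t\<bar> \<le> bd (sup_norm_on {- \<tau>..0} x0)" if "t \<ge> - \<tau>" for t
      using that by (intro bound[OF x0])
    then show ?thesis unfolding bounded_iff by auto
  qed
  moreover have "\<exists>\<delta>>0. \<forall>x0\<in>?X. sup_norm_on {- \<tau>..0} x0 < \<delta> \<longrightarrow> sup_norm_on {- \<tau>..} (?A x0) < \<epsilon>"
    if \<epsilon>: "\<epsilon> > 0" for \<epsilon>
  proof -
    have "isCont bd 0" unfolding bd_def[abs_def] using \<tau> by (intro continuous_intros) auto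
    moreover have "bd 0 = 0" by (simp add: bd_def)
    ultimately obtain d where d: "d > 0" "\<And>\<delta>. \<bar>\<delta>\<bar> < d \<Longrightarrow> \<bar>bd \<delta>\<bar> < \<epsilon> / 2"
      using \<epsilon> unfolding continuous_at_eps_delta dist_real_def by (metis diff_zero half_gt_zero)
    define \<delta> where "\<delta> = d / 2"
    have "sup_norm_on {- \<tau>..} (?A x0) < \<epsilon>" if x0: "x0 \<in> ?X" and small: "sup_norm_on {- \<tau>..0} x0 < \<delta>" for x0
    proof -
      have "\<bar>x0 \<theta>\<bar> \<le> \<delta>" if "\<theta> \<in> {- \<tau>..0}" for \<theta>
        using cSUP_upper[OF that init_bdd[OF x0]] small by (simp add: sup_norm_on_def)
      then have "\<bar>?A x0 t\<bar> \<le> bd \<delta>" if "t \<ge> - \<tau>" for t using that by (intro bound[OF x0])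
      then have "sup_norm_on {- \<tau>..} (?A x0) \<le> bd \<delta>"
        unfolding sup_norm_on_def by (intro cSUP_least) auto
      moreover have "\<bar>bd \<delta>\<bar> < \<epsilon> / 2" using d(1) by (intro d(2)) (simp add: \<delta>_def)
      ultimately show ?thesis using \<epsilon> by linarith
    qed
    then show ?thesis using d(1) by (intro exI[of _ \<delta>]) (auto simp: \<delta>_def)
  qed
  moreover have "(?A x0 \<longlongrightarrow> 0) at_top" if x0: "x0 \<in> ?X" for x0
  proof -
    obtain y U where yU: "delayed_reflection \<alpha> L y U"
      and A: "\<And>t. t \<ge> - \<tau> \<Longrightarrow> ?A x0 t = \<tau> / \<alpha> * y (t / \<tau>)"
      using solution_map_rescaled[OF \<tau> \<alpha> L p0 x0] by metis
    interpret delayed_reflection \<alpha> L y U by (rule yU)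
    have "(y \<longlongrightarrow> 0) at_top" by (rule y_tendsto_0) (use slope in \<open>simp add: k_def\<close>)
    moreover have "filterlim (\<lambda>t. t / \<tau>) at_top at_top"
      using filterlim_tendsto_pos_mult_at_top[OF tendsto_const[of "1 / \<tau>"] _ filterlim_ident] \<tau> by simp
    ultimately have "((\<lambda>t. y (t / \<tau>)) \<longlongrightarrow> 0) at_top" by (rule filterlim_compose)
    then have "((\<lambda>t. \<tau> / \<alpha> * y (t / \<tau>)) \<longlongrightarrow> 0) at_top" by (rule tendsto_mult_right_zero)
    moreover have "\<forall>\<^sub>F t in at_top. ?A x0 t = \<tau> / \<alpha> * y (t / \<tau>)"
      using eventually_ge_at_top[of "- \<tau>"] by eventually_elim (rule A)
    ultimately show ?thesis by (simp add: tendsto_cong)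
  qed
  moreover have "\<exists>!z. is_solution \<tau> \<alpha> p0 x0 z" if x0: "x0 \<in> ?X" for x0
  proof -
    have "is_solution \<tau> \<alpha> p0 x0 (?A x0)"
      using solution_map_rescaled[OF \<tau> \<alpha> L p0 x0] by metis
    then show ?thesis using solution_unique[OF \<tau>] by blast
  qed
  ultimately show ?thesis
    unfolding asymptotically_stable_on_def stable_on_def by blast
qed

end
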